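(* Let $\mathfrak h=\mathfrak h_-\oplus\mathfrak h_0\oplus\mathfrak h_+$ be a graded Lie algebra with a Euclidean metric $\langle\cdot,\cdot\rangle$ adapted to the gradation. (i) For $k\ge0$ the codifferential $\partial^*:C^{k+1}(\mathfrak h_-,\mathfrak h)\to C^k(\mathfrak h_-,\mathfrak h)$ has the following expression: for any $\alpha_0,\dots,\alpha_k\in\mathfrak h_-^*$ and $V\in\mathfrak h$, $$\partial^*\big((\alpha_0\wedge\cdots\wedge\alpha_k)\otimes V\big)=\sum_{i=0}^k(-1)^i(\alpha_0\wedge\cdots\wedge\widehat{\alpha_i}\wedge\cdots\wedge\alpha_k)\otimes(\mathrm{ad}_{\alpha_i^\flat})^*(V)$$ $$+\sum_{i<j}(-1)^{i+j}\big([\alpha_i^\flat,\alpha_j^\flat]^\sharp\wedge\alpha_0\wedge\cdots\wedge\widehat{\alpha_i}\wedge\cdots\wedge\widehat{\alpha_j}\wedge\cdots\wedge\alpha_k\big)\otimes V.$$ (ii) The metric $\langle\cdot,\cdot\rangle$ is admissible if and only if $$\mathrm{Ad}_g^*([Z,W])=[(\mathrm{Ad}_g^-)^*(Z),(\mathrm{Ad}_g)^*(W)],\quad\forall g\in Q,\ \forall Z\in\mathfrak h_-,\ \forall W\in\mathfrak h,$$ and $$(\mathrm{Ad}_g^-)^*([Z,W])=[(\mathrm{Ad}_g^-)^*(Z),(\mathrm{Ad}_g^-)^*(W)],\quad\forall g\in Q,\ \forall Z,W\in\mathfrak h_-.$$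
   Context: $\mathfrak{h}=\mathfrak{h}_{-k_0}\oplus\cdots\oplus\mathfrak{h}_{l}$ ($k_0>0$, $l\ge0$) is a finite dimensional graded Lie algebra, $[\mathfrak{h}_i,\mathfrak{h}_j]\subset\mathfrak{h}_{i+j}$, and the gradation is assumed fundamental: $\mathfrak{h}_-:=\oplus_{i<0}\mathfrak{h}_i$ is generated by $\mathfrak{h}_{-1}$; $\mathfrak{h}_0,\mathfrak{h}_{-k_0},\mathfrak{h}_l$ are non-trivial; the adjoint action of $\mathfrak{h}_0$ on $\mathfrak{h}_{-1}$ is exact (faithful). $\mathfrak{h}_+=\oplus_{i>0}\mathfrak{h}_i$, $\mathfrak q=\mathfrak h_0\oplus\mathfrak h_+$. $H$ is a connected Lie group with Lie algebra $\mathfrak h$ and $Q$ its connected subgroup with Lie algebra $\mathfrak q$. A Euclidean metric on $\mathfrak h$ is adapted to the gradation if $\langle\mathfrak h_i,\mathfrak h_j\rangle=0$ for $i\ne j$. $C^k(\mathfrak h_-,\mathfrak h)=\Lambda^k(\mathfrak h_-^* )\otimes\mathfrak h$, with Lie algebra differential $\partial:C^k\to C^{k+1}$, $$(\partial\phi)(X_0,\dots,X_k)=\sum_i(-1)^i[X_i,\phi(X_0,\dots,\widehat{X_i},\dots,X_k)]+\sum_{i<j}(-1)^{i+j}\phi([X_i,X_j],X_0,\dots,\widehat{X_i},\dots,\widehat{X_j},\dots,X_k)$$ (hats denote omitted arguments). $C^k(\mathfrak h_-,\mathfrak h)$ carries the natural Euclidean metric induced by $\langle\cdot,\cdot\rangle$: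 with $\langle\beta_1\wedge\cdots\wedge\beta_k,\gamma_1\wedge\cdots\wedge\gamma_k\rangle=\det(\langle\beta_i,\gamma_j\rangle)$ on $\Lambda^k\mathfrak h_-^*$, tensored with the metric on $\mathfrak h$. $\partial^*$ is the metric adjoint of $\partial$. $Q$ acts on $\mathfrak h_-\cong\mathfrak h/\mathfrak q$ by the action induced by the adjoint action, denoted $\mathrm{Ad}^-_g$ ($g\in Q$), and dually on $\mathfrak h_-^*$. $\mathrm{Ad}_g^*=(\mathrm{Ad}_g)^*:\mathfrak h\to\mathfrak h$, $(\mathrm{Ad}^-_g)^*:\mathfrak h_-\to\mathfrak h_-$ and $(\mathrm{ad}_X)^*:\mathfrak h\to\mathfrak h$ ($X\in\mathfrak h$) denote the metric adjoints of $\mathrm{Ad}_g:\mathfrak h\to\mathfrak h$, $\mathrm{Ad}^-_g:\mathfrak h_-\to\mathfrak h_-$ and $\mathrm{ad}_X:\mathfrak h\to\mathfrak h$. $X^\sharp=\langle X,\cdot\rangle\in\mathfrak h_-^*$ for $X\in\mathfrak h_-$, with inverse $\mathfrak h_-^*\ni\gamma\mapsto\gamma^\flat\in\mathfrak h_-$. $Q$ acts on $C^k(\mathfrak h_-,\mathfrak h)$ by $(g\cdot\phi)(X_1,\dots,X_k)=\mathrm{Ad}_g(\phi(\mathrm{Ad}^-_{g^{-1}}X_1,\dots,\mathrm{Ad}^-_{g^{-1}}X_k))$. The metric is admissible if $\partial^*:C^{k+1}(\mathfrak h_-,\mathfrak h)\to C^k(\mathfrak h_-,\mathfrak h)$ is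 $Q$-invariant (commutes with the $Q$-actions) for every $k\ge0$. *)

theory Defs
  imports "HOL-Analysis.Analysis" "HOL-Algebra.Group" "Jordan_Normal_Form.Determinant"
begin

no_notation scalar_prod (infix "\<bullet>" 70)

section \<open>Lie groups\<close>

text \<open>Intended for open sets \<open>S\<close> only, where this is the usual notion of class \<open>C\<^sup>k\<close>.\<close>

fun Ck_on :: "nat \<Rightarrow> 'a::euclidean_space set \<Rightarrow> ('a \<Rightarrow> 'b::euclidean_space) \<Rightarrow> bool" where
  "Ck_on 0 S f \<longleftrightarrow> continuous_on S f"
| "Ck_on (Suc k) S f \<longleftrightarrow> (\<forall>x\<in>S. f differentiable (at x)) \<and>
     (\<forall>v. Ck_on k S (\<lambda>x. frechet_derivative f (at x) v))"

definition smooth_on :: "'a::euclidean_space set \<Rightarrow> ('a \<Rightarrow> 'b::euclidean_space) \<Rightarrow> bool" where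
  "smooth_on S f \<longleftrightarrow> (\<forall>k. Ck_on k S f)"

type_synonym ('m, 'e) chart = "'m set \<times> ('m \<Rightarrow> 'e)"

definition chart_inv :: "('m, 'e) chart \<Rightarrow> 'e \<Rightarrow> 'm" where
  "chart_inv c = inv_into (fst c) (snd c)"

definition local_rep :: "('m, 'e) chart \<Rightarrow> ('n, 'f) chart \<Rightarrow> ('m \<Rightarrow> 'n) \<Rightarrow> 'e \<Rightarrow> 'f" where
  "local_rep c d f = snd d \<circ> f \<circ> chart_inv c"

text \<open>The differential of \<open>f\<close> at \<open>p\<close>, read in a chart \<open>c\<close> around \<open>p\<close> and a chart \<open>d\<close> around \<open>f p\<close>.\<close>

definition chart_deriv ::
  "('m, 'e::euclidean_space) chart \<Rightarrow> ('n, 'f::euclidean_space) chart \<Rightarrow> ('m \<Rightarrow> 'n) \<Rightarrow> 'm \<Rightarrow> 'e \<Rightarrow> 'f" where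
  "chart_deriv c d f p = frechet_derivative (local_rep c d f) (at (snd c p))"

definition second_countable_space :: "'m topology \<Rightarrow> bool" where
  "second_countable_space T \<longleftrightarrow>
     (\<exists>\<B>. countable \<B> \<and> (\<forall>B\<in>\<B>. openin T B) \<and>
        (\<forall>W p. openin T W \<and> p \<in> W \<longrightarrow> (\<exists>B\<in>\<B>. p \<in> B \<and> B \<subseteq> W)))"

locale smooth_manifold =
  fixes T :: "'m topology" and A :: "('m, 'e::euclidean_space) chart set"
  assumes Hausdorff: "Hausdorff_space T"
    and second_countable: "second_countable_space T"
    and chart_dom: "c \<in> A \<Longrightarrow> openin T (fst c)"
    and chart_range: "c \<in> A \<Longrightarrow> open (snd c ` fst c)"
    and chart_homeo: "c \<in> A \<Longrightarrow>
      homeomorphic_map (subtopology T (fst c)) (top_of_set (snd c ` fst c)) (snd c)"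
    and cover: "(\<Union>c\<in>A. fst c) = topspace T"
    and compatible: "\<lbrakk>c \<in> A; d \<in> A\<rbrakk> \<Longrightarrow> smooth_on (snd c ` (fst c \<inter> fst d)) (local_rep c d id)"

definition smooth_map ::
  "'m topology \<Rightarrow> ('m, 'e::euclidean_space) chart set \<Rightarrow>
   'n topology \<Rightarrow> ('n, 'f::euclidean_space) chart set \<Rightarrow> ('m \<Rightarrow> 'n) \<Rightarrow> bool" where
  "smooth_map T A T' A' f \<longleftrightarrow> continuous_map T T' f \<and>
     (\<forall>c\<in>A. \<forall>d\<in>A'. smooth_on (snd c ` {p \<in> fst c. f p \<in> fst d}) (local_rep c d f))"

definition immersion ::
  "'m topology \<Rightarrow> ('m, 'e::euclidean_space) chart set \<Rightarrow>
   'n topology \<Rightarrow> ('n, 'f::euclidean_space) chart set \<Rightarrow> ('m \<Rightarrow> 'n) \<Rightarrow> bool" where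
  "immersion T A T' A' f \<longleftrightarrow> smooth_map T A T' A' f \<and>
     (\<forall>c\<in>A. \<forall>d\<in>A'. \<forall>p\<in>fst c. f p \<in> fst d \<longrightarrow> inj (chart_deriv c d f p))"

definition prod_atlas ::
  "('m, 'e) chart set \<Rightarrow> ('n, 'f) chart set \<Rightarrow> ('m \<times> 'n, 'e \<times> 'f) chart set" where
  "prod_atlas A B = {(fst c \<times> fst d, map_prod (snd c) (snd d)) | c d. c \<in> A \<and> d \<in> B}"

locale lie_group = group G + smooth_manifold T A
  for G :: "'g monoid" (structure) and T :: "'g topology" and A :: "('g, 'e::euclidean_space) chart set" +
  assumes carrier_eq: "carrier G = topspace T"
    and smooth_mult:
      "smooth_map (prod_topology T T) (prod_atlas A A) T A (\<lambda>(x, y). x \<otimes> y)"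
    and smooth_inv: "smooth_map T A T A (\<lambda>x. inv x)"

text \<open>The value at the point with coordinates \<open>x\<close> of the left-invariant vector field generated by the
  tangent vector \<open>X\<close> at \<open>\<one>\<close>, everything read in the chart \<open>c\<close> around \<open>\<one>\<close>.\<close>

definition left_invariant_field ::
  "'g monoid \<Rightarrow> ('g, 'e::euclidean_space) chart \<Rightarrow> 'e \<Rightarrow> 'e \<Rightarrow> 'e" where
  "left_invariant_field G c X x = chart_deriv c c (\<lambda>p. chart_inv c x \<otimes>\<^bsub>G\<^esub> p) \<one>\<^bsub>G\<^esub> X"

text \<open>The commutator \<open>[\<xi>, \<eta>] = D\<eta> \<xi> - D\<xi> \<eta>\<close> of left-invariant vector fields, evaluated at \<open>\<one>\<close>.\<close>

definition lie_bracket_at_one ::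
  "'g monoid \<Rightarrow> ('g, 'e::euclidean_space) chart \<Rightarrow> 'e \<Rightarrow> 'e \<Rightarrow> 'e" where
  "lie_bracket_at_one G c X Y =
     frechet_derivative (left_invariant_field G c Y) (at (snd c \<one>\<^bsub>G\<^esub>)) X -
     frechet_derivative (left_invariant_field G c X) (at (snd c \<one>\<^bsub>G\<^esub>)) Y"

text \<open>A connected Lie group whose Lie algebra is the Lie algebra \<open>br\<close> on the type \<open>'h\<close>.
  The tangent space at \<open>\<one>\<close> is identified with \<open>'h\<close> by the differential of the chart \<open>c\<close>.  This
  is no restriction: every linear isomorphism from the tangent space at \<open>\<one>\<close> onto \<open>'h\<close> is
  the differential of some chart, and \<open>A\<close> may be a maximal atlas.\<close>

locale connected_lie_group_with_algebra = lie_group H T A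
  for H :: "'g monoid" (structure) and T :: "'g topology"
    and A :: "('g, 'h::euclidean_space) chart set" and c :: "('g, 'h) chart"
    and br :: "'h \<Rightarrow> 'h \<Rightarrow> 'h" +
  assumes connected: "connected_space T"
    and chart_at_one: "c \<in> A" "\<one> \<in> fst c"
    and bracket_eq: "br X Y = lie_bracket_at_one H c X Y"

text \<open>\<open>Q\<close>, with its own topology and atlas, is a connected (immersed, not necessarily closed) Lie
  subgroup of \<open>H\<close> whose Lie algebra is the subspace \<open>\<qq>\<close>.\<close>

definition connected_lie_subgroup_with_algebra ::
  "'g set \<Rightarrow> 'g topology \<Rightarrow> ('g, 'q::euclidean_space) chart set \<Rightarrow>
   'g monoid \<Rightarrow> 'g topology \<Rightarrow> ('g, 'h::euclidean_space) chart set \<Rightarrow> ('g, 'h) chart \<Rightarrow> 'h set \<Rightarrow> bool" where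
  "connected_lie_subgroup_with_algebra Q TQ AQ H T A c \<qq> \<longleftrightarrow>
     subgroup Q H \<and> lie_group (H\<lparr>carrier := Q\<rparr>) TQ AQ \<and> connected_space TQ \<and>
     immersion TQ AQ T A id \<and>
     (\<forall>d\<in>AQ. \<one>\<^bsub>H\<^esub> \<in> fst d \<longrightarrow> range (chart_deriv d c id \<one>\<^bsub>H\<^esub>) = \<qq>)"

definition Ad :: "'g monoid \<Rightarrow> ('g, 'h::euclidean_space) chart \<Rightarrow> 'g \<Rightarrow> 'h \<Rightarrow> 'h" where
  "Ad H c g = chart_deriv c c (\<lambda>x. g \<otimes>\<^bsub>H\<^esub> x \<otimes>\<^bsub>H\<^esub> inv\<^bsub>H\<^esub> g) \<one>\<^bsub>H\<^esub>"


section \<open>Graded Lie algebras\<close>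

locale lie_algebra =
  fixes br :: "'h::real_vector \<Rightarrow> 'h \<Rightarrow> 'h"
  assumes add_left: "br (X + Y) Z = br X Z + br Y Z"
    and add_right: "br X (Y + Z) = br X Y + br X Z"
    and scale_left: "br (a *\<^sub>R X) Y = a *\<^sub>R br X Y"
    and scale_right: "br X (a *\<^sub>R Y) = a *\<^sub>R br X Y"
    and alternating: "br X X = 0"
    and Jacobi: "br X (br Y Z) + br Y (br Z X) + br Z (br X Y) = 0"

definition lie_subalgebra :: "('h::real_vector \<Rightarrow> 'h \<Rightarrow> 'h) \<Rightarrow> 'h set \<Rightarrow> bool" where
  "lie_subalgebra br L \<longleftrightarrow> subspace L \<and> (\<forall>X\<in>L. \<forall>Y\<in>L. br X Y \<in> L)"

definition neg_part :: "(int \<Rightarrow> 'h::real_vector set) \<Rightarrow> 'h set" where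
  "neg_part h = span (\<Union>i\<in>{..<0}. h i)"

definition nonneg_part :: "(int \<Rightarrow> 'h::real_vector set) \<Rightarrow> 'h set" where
  "nonneg_part h = span (\<Union>i\<in>{0..}. h i)"

locale fundamental_graded_lie_algebra = lie_algebra br
  for br :: "'h::euclidean_space \<Rightarrow> 'h \<Rightarrow> 'h" and h :: "int \<Rightarrow> 'h set" and k0 l :: int +
  assumes depth: "k0 > 0" "l \<ge> 0"
    and homogeneous_subspace: "subspace (h i)"
    and outside: "i < - k0 \<or> l < i \<Longrightarrow> h i = {0}"
    and direct_sum: "\<exists>!x :: int \<Rightarrow> 'h. (\<forall>i. x i \<in> h i) \<and> X = (\<Sum>i = - k0..l. x i)"
    and bracket_degree: "\<lbrakk>X \<in> h i; Y \<in> h j\<rbrakk> \<Longrightarrow> br X Y \<in> h (i + j)"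
    and generated: "neg_part h = lie_subalgebra br hull h (- 1)"
    and nontrivial: "h 0 \<noteq> {0}" "h (- k0) \<noteq> {0}" "h l \<noteq> {0}"
    and faithful: "\<lbrakk>B \<in> h 0; \<forall>X \<in> h (- 1). br B X = 0\<rbrakk> \<Longrightarrow> B = 0"

text \<open>The Euclidean metric on the Lie algebra is the inner product of the type.\<close>

definition adapted_metric :: "(int \<Rightarrow> 'h::real_inner set) \<Rightarrow> bool" where
  "adapted_metric h \<longleftrightarrow> (\<forall>i j. i \<noteq> j \<longrightarrow> (\<forall>X\<in>h i. \<forall>Y\<in>h j. inner X Y = 0))"

text \<open>Metric adjoint of an endomorphism of a subspace; for endomorphisms of the whole type the
  library's \<open>adjoint\<close> is used.\<close>

definition adjoint_on :: "'h::real_inner set \<Rightarrow> ('h \<Rightarrow> 'h) \<Rightarrow> 'h \<Rightarrow> 'h" where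
  "adjoint_on S f Y = (THE Z. Z \<in> S \<and> (\<forall>X\<in>S. inner (f X) Y = inner X Z))"

text \<open>\<open>Y\<close> in the negative part represents the class of \<open>Ad g X\<close> modulo the nonnegative part.\<close>

definition Ad_neg ::
  "'g monoid \<Rightarrow> ('g, 'h::euclidean_space) chart \<Rightarrow> (int \<Rightarrow> 'h set) \<Rightarrow> 'g \<Rightarrow> 'h \<Rightarrow> 'h" where
  "Ad_neg H c h g X = (THE Y. Y \<in> neg_part h \<and> Ad H c g X - Y \<in> nonneg_part h)"


section \<open>Cochains\<close>

text \<open>Functionals on a subspace \<open>S\<close> are functions on the whole type of which only the values on \<open>S\<close>
  matter.\<close>

definition dual :: "'h::real_vector set \<Rightarrow> ('h \<Rightarrow> real) set" where
  "dual S = {\<alpha>. (\<forall>X\<in>S. \<forall>Y\<in>S. \<alpha> (X + Y) = \<alpha> X + \<alpha> Y) \<and> (\<forall>a. \<forall>X\<in>S. \<alpha> (a *\<^sub>R X) = a * \<alpha> X)}"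

definition flat :: "'h::real_inner set \<Rightarrow> ('h \<Rightarrow> real) \<Rightarrow> 'h" where
  "flat S \<alpha> = (THE Z. Z \<in> S \<and> (\<forall>X\<in>S. inner Z X = \<alpha> X))"

definition sharp :: "'h::real_inner \<Rightarrow> 'h \<Rightarrow> real" where
  "sharp X = (\<lambda>Y. inner X Y)"

definition tuples :: "'h set \<Rightarrow> nat \<Rightarrow> 'h list set" where
  "tuples S k = {Xs. length Xs = k \<and> set Xs \<subseteq> S}"

text \<open>\<open>\<Lambda>\<^sup>k S\<^sup>* \<otimes> 'h\<close> as the space of alternating \<open>k\<close>-linear maps \<open>S\<^sup>k \<rightarrow> 'h\<close>, where maps take a list of
  arguments and are \<open>0\<close> by convention outside \<open>S\<^sup>k\<close>.\<close>

definition cochains :: "'h::real_vector set \<Rightarrow> nat \<Rightarrow> ('h list \<Rightarrow> 'h) set" where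
  "cochains S k = {\<phi>.
     (\<forall>Xs. Xs \<notin> tuples S k \<longrightarrow> \<phi> Xs = 0) \<and>
     (\<forall>Xs\<in>tuples S k. \<forall>i<k. \<forall>X\<in>S. \<forall>Y\<in>S. \<phi> (Xs[i := X + Y]) = \<phi> (Xs[i := X]) + \<phi> (Xs[i := Y])) \<and>
     (\<forall>Xs\<in>tuples S k. \<forall>i<k. \<forall>X\<in>S. \<forall>a. \<phi> (Xs[i := a *\<^sub>R X]) = a *\<^sub>R \<phi> (Xs[i := X])) \<and>
     (\<forall>Xs\<in>tuples S k. \<forall>i<k. \<forall>j<k. i \<noteq> j \<and> Xs ! i = Xs ! j \<longrightarrow> \<phi> Xs = 0)}"

text \<open>\<open>(\<alpha>\<^sub>1 \<and> \<dots> \<and> \<alpha>\<^sub>k) \<otimes> V\<close>, with the convention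
  \<open>(\<alpha>\<^sub>1 \<and> \<dots> \<and> \<alpha>\<^sub>k)(X\<^sub>1, \<dots>, X\<^sub>k) = det (\<alpha>\<^sub>i (X\<^sub>j))\<close>.\<close>

definition wedge_tensor :: "'h::real_vector set \<Rightarrow> ('h \<Rightarrow> real) list \<Rightarrow> 'h \<Rightarrow> 'h list \<Rightarrow> 'h" where
  "wedge_tensor S \<alpha>s V Xs =
     (if Xs \<in> tuples S (length \<alpha>s)
      then Determinant.det (Matrix.mat (length \<alpha>s) (length \<alpha>s) (\<lambda>(i, j). (\<alpha>s ! i) (Xs ! j))) *\<^sub>R V
      else 0)"

text \<open>The inner product on \<open>\<Lambda>\<^sup>k S\<^sup>* \<otimes> 'h\<close>: the bilinear form determined by
  \<open>\<langle>(\<beta>\<^sub>1 \<and> \<dots> \<and> \<beta>\<^sub>k) \<otimes> V, (\<gamma>\<^sub>1 \<and> \<dots> \<and> \<gamma>\<^sub>k) \<otimes> W\<rangle> = det (\<langle>\<beta>\<^sub>i, \<gamma>\<^sub>j\<rangle>) \<langle>V, W\<rangle>\<close>, and \<open>0\<close> by convention on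
  functions that are not cochains.\<close>

definition is_induced_metric ::
  "'h::euclidean_space set \<Rightarrow> nat \<Rightarrow> (('h list \<Rightarrow> 'h) \<Rightarrow> ('h list \<Rightarrow> 'h) \<Rightarrow> real) \<Rightarrow> bool" where
  "is_induced_metric S k B \<longleftrightarrow>
     (\<forall>\<phi> \<psi>. \<phi> \<notin> cochains S k \<or> \<psi> \<notin> cochains S k \<longrightarrow> B \<phi> \<psi> = 0) \<and>
     (\<forall>\<phi>\<in>cochains S k. \<forall>\<psi>\<in>cochains S k. \<forall>\<omega>\<in>cochains S k. \<forall>a b.
        B (\<lambda>Xs. a *\<^sub>R \<phi> Xs + b *\<^sub>R \<psi> Xs) \<omega> = a * B \<phi> \<omega> + b * B \<psi> \<omega> \<and>
        B \<omega> (\<lambda>Xs. a *\<^sub>R \<phi> Xs + b *\<^sub>R \<psi> Xs) = a * B \<omega> \<phi> + b * B \<omega> \<psi>) \<and>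
     (\<forall>\<beta>s \<gamma>s V W. set \<beta>s \<subseteq> dual S \<and> set \<gamma>s \<subseteq> dual S \<and> length \<beta>s = k \<and> length \<gamma>s = k \<longrightarrow>
        B (wedge_tensor S \<beta>s V) (wedge_tensor S \<gamma>s W) =
          Determinant.det (Matrix.mat k k (\<lambda>(i, j). inner (flat S (\<beta>s ! i)) (flat S (\<gamma>s ! j)))) * inner V W)"

definition cochain_inner ::
  "'h::euclidean_space set \<Rightarrow> nat \<Rightarrow> ('h list \<Rightarrow> 'h) \<Rightarrow> ('h list \<Rightarrow> 'h) \<Rightarrow> real" where
  "cochain_inner S k = (THE B. is_induced_metric S k B)"

text \<open>The differential from \<open>k\<close>-cochains to \<open>(k + 1)\<close>-cochains; \<open>nths Xs (- {i, j})\<close> omits the entries at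
  the positions \<open>i\<close> and \<open>j\<close>.\<close>

definition differential ::
  "('h::real_vector \<Rightarrow> 'h \<Rightarrow> 'h) \<Rightarrow> 'h set \<Rightarrow> nat \<Rightarrow> ('h list \<Rightarrow> 'h) \<Rightarrow> 'h list \<Rightarrow> 'h" where
  "differential br S k \<phi> Xs =
     (if Xs \<in> tuples S (Suc k)
      then (\<Sum>i\<le>k. (- 1) ^ i *\<^sub>R br (Xs ! i) (\<phi> (nths Xs (- {i})))) +
           (\<Sum>j\<le>k. \<Sum>i<j. (- 1) ^ (i + j) *\<^sub>R \<phi> (br (Xs ! i) (Xs ! j) # nths Xs (- {i, j})))
      else 0)"

text \<open>The metric adjoint of \<open>differential br S k\<close>, mapping \<open>(k + 1)\<close>-cochains to \<open>k\<close>-cochains.\<close>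

definition codifferential ::
  "('h::euclidean_space \<Rightarrow> 'h \<Rightarrow> 'h) \<Rightarrow> 'h set \<Rightarrow> nat \<Rightarrow> ('h list \<Rightarrow> 'h) \<Rightarrow> 'h list \<Rightarrow> 'h" where
  "codifferential br S k \<phi> = (THE \<psi>. \<psi> \<in> cochains S k \<and>
     (\<forall>\<omega>\<in>cochains S k.
        cochain_inner S (Suc k) (differential br S k \<omega>) \<phi> = cochain_inner S k \<omega> \<psi>))"

definition cochain_action ::
  "'g monoid \<Rightarrow> ('g, 'h::euclidean_space) chart \<Rightarrow> (int \<Rightarrow> 'h set) \<Rightarrow> nat \<Rightarrow> 'g \<Rightarrow> ('h list \<Rightarrow> 'h) \<Rightarrow> 'h list \<Rightarrow> 'h" where
  "cochain_action H c h k g \<phi> Xs =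
     (if Xs \<in> tuples (neg_part h) k
      then Ad H c g (\<phi> (map (Ad_neg H c h (inv\<^bsub>H\<^esub> g)) Xs))
      else 0)"

definition admissible_metric ::
  "('h::euclidean_space \<Rightarrow> 'h \<Rightarrow> 'h) \<Rightarrow> (int \<Rightarrow> 'h set) \<Rightarrow> 'g monoid \<Rightarrow> ('g, 'h) chart \<Rightarrow> 'g set \<Rightarrow> bool" where
  "admissible_metric br h H c Q \<longleftrightarrow>
     (\<forall>k. \<forall>g\<in>Q. \<forall>\<phi>\<in>cochains (neg_part h) (Suc k).
        codifferential br (neg_part h) k (cochain_action H c h (Suc k) g \<phi>) =
        cochain_action H c h k g (codifferential br (neg_part h) k \<phi>))"

end

theory Submission
  imports Defs
begin

text \<open>The induced metric has one property from which everything about \<open>\<partial>\<^sup>*\<close> follows: for every \<open>k\<close>-cochain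
  \<open>\<phi>\<close>,
  \<open>\<langle>\<phi>, (\<gamma>\<^sub>1 \<and> \<dots> \<and> \<gamma>\<^sub>k) \<otimes> V\<rangle> = \<langle>\<phi>(\<gamma>\<^sub>1\<^sup>\<flat>, \<dots>, \<gamma>\<^sub>k\<^sup>\<flat>), V\<rangle>\<close>
  (\<open>cochain_inner_wedge\<close>).  To see this, and at the same time that a bilinear form with the prescribed
  values on decomposable cochains exists, one takes an orthonormal basis \<open>E\<close> of \<open>\<hh>\<^sub>-\<close> and the form
  \<open>1/k! \<Sum> \<langle>\<phi>(e\<^sub>1, \<dots>, e\<^sub>k), \<psi>(e\<^sub>1, \<dots>, e\<^sub>k)\<rangle>\<close>, summed over all \<open>k\<close>-tuples from \<open>E\<close>: expanding a determinant by
  permutations and \<open>\<phi>\<close> by multilinearity, each of the \<open>k!\<close> permutations contributes the same value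
  (\<open>sum_frame_det\<close>).  The same computation shows that decomposable cochains span
  (\<open>cochain_induct\<close>), so the form is unique and the metric adjoint is determined by its values on
  decomposable cochains.

  Applied to \<open>\<phi> = \<partial>\<omega>\<close>, the property evaluates \<open>\<partial>\<omega>\<close> on \<open>\<alpha>\<^sub>0\<^sup>\<flat>, \<dots>, \<alpha>\<^sub>k\<^sup>\<flat>\<close>; moving \<open>ad\<close> to the other side of
  the scalar product and reading the property backwards in every summand gives the formula for
  \<open>\<partial>\<^sup>*\<close> (\<open>codifferential_wedge\<close>).  This needs \<open>\<partial>\<omega>\<close> to be a cochain, which is proved by induction
  on the degree with Cartan's formula \<open>\<iota>\<^sub>X \<partial> + \<partial> \<iota>\<^sub>X = L\<^sub>X\<close> (\<open>differential_in_cochains\<close>).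

  For the second part, \<open>g \<in> Q\<close> maps \<open>(\<alpha>\<^sub>0 \<and> \<dots> \<and> \<alpha>\<^sub>k) \<otimes> V\<close> to the decomposable cochain with covectors
  \<open>\<alpha>\<^sub>i \<circ> Ad\<^sup>-\<^sub>g\<^sub>'\<close> and value \<open>Ad\<^sub>g V\<close>, where \<open>g'\<close> is the inverse of \<open>g\<close>, and
  \<open>(\<alpha> \<circ> Ad\<^sup>-\<^sub>g\<^sub>')\<^sup>\<flat> = (Ad\<^sup>-\<^sub>g\<^sub>')\<^sup>* \<alpha>\<^sup>\<flat>\<close>.  The two terms of the formula are compatible with this
  if \<open>Ad\<^sub>g\<close> intertwines \<open>(ad\<^sub>Z)\<^sup>*\<close> with \<open>(ad\<^sub>Y)\<^sup>*\<close> for \<open>Y = (Ad\<^sup>-\<^sub>g\<^sub>')\<^sup>* Z\<close>, and if \<open>(Ad\<^sup>-\<^sub>g\<^sub>')\<^sup>*\<close> preserves the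
  bracket of \<open>\<hh>\<^sub>-\<close>.  Conversely the case \<open>k = 0\<close> of invariance is the first condition, and given it,
  \<open>k = 1\<close> is the second.  Taking adjoints, and using that \<open>(Ad\<^sup>-\<^sub>g\<^sub>')\<^sup>*\<close> is inverse to
  \<open>(Ad\<^sup>-\<^sub>g)\<^sup>*\<close>, turns these conditions into the stated ones (\<open>codifferential_equivariant_iff\<close>).
  The facts about the groups behind this are that \<open>Ad\<^sub>g\<close> is linear, that \<open>Ad\<^sub>g\<close> and \<open>Ad\<^sub>g\<^sub>'\<close> are inverse to each
  other, and that \<open>Ad\<^sub>g\<close> preserves \<open>\<qq>\<close>, so that it acts on the quotient by \<open>\<qq>\<close>.  These follow from
  the chain rule for conjugations.\<close>

section \<open>Tuples and omission of entries\<close>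

lemma tuples_0 [simp]: "tuples S 0 = {[]}"
  by (auto simp: tuples_def)

lemma Cons_in_tuples [simp]: "X # Xs \<in> tuples S (Suc k) \<longleftrightarrow> X \<in> S \<and> Xs \<in> tuples S k"
  by (auto simp: tuples_def)

lemma tuples_SucE:
  assumes "Xs \<in> tuples S (Suc k)"
  obtains X Ys where "Xs = X # Ys" "X \<in> S" "Ys \<in> tuples S k"
  using assms by (cases Xs) (auto simp: tuples_def)

lemma tuples_length: "Xs \<in> tuples S k \<Longrightarrow> length Xs = k"
  by (simp add: tuples_def)

lemma tuples_nth: "Xs \<in> tuples S k \<Longrightarrow> i < k \<Longrightarrow> Xs ! i \<in> S"
  by (auto simp: tuples_def)

lemma tuples_update: "Xs \<in> tuples S k \<Longrightarrow> X \<in> S \<Longrightarrow> Xs[i := X] \<in> tuples S k"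
  by (auto simp: tuples_def dest: set_update_subset_insert[THEN subsetD])

lemma nths_Cons_minus_zero [simp]: "nths (X # Xs) (- {0}) = Xs"
  by (simp add: nths_Cons nths_all)

lemma nths_Cons_minus_Suc [simp]: "nths (X # Xs) (- {Suc i}) = X # nths Xs (- {i})"
  by (simp add: nths_Cons) (rule arg_cong[where f = "nths Xs"], auto)

lemma nths_Cons_minus_zero_Suc [simp]: "nths (X # Xs) (- {0, Suc j}) = nths Xs (- {j})"
  by (simp add: nths_Cons) (rule arg_cong[where f = "nths Xs"], auto)

lemma nths_Cons_minus_Suc_Suc [simp]:
  "nths (X # Xs) (- {Suc i, Suc j}) = X # nths Xs (- {i, j})"
  by (simp add: nths_Cons) (rule arg_cong[where f = "nths Xs"], auto)

lemma nths_minus_one_in_tuples: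
  "Xs \<in> tuples S (Suc k) \<Longrightarrow> i \<le> k \<Longrightarrow> nths Xs (- {i}) \<in> tuples S k"
proof (induction k arbitrary: Xs i)
  case 0
  then show ?case by (auto elim!: tuples_SucE)
next
  case (Suc k)
  then show ?case by (cases i) (auto elim!: tuples_SucE[of Xs])
qed

lemma nths_minus_two_in_tuples:
  "Xs \<in> tuples S (Suc (Suc k)) \<Longrightarrow> i < j \<Longrightarrow> j \<le> Suc k \<Longrightarrow> nths Xs (- {i, j}) \<in> tuples S k"
proof (induction k arbitrary: Xs i j)
  case 0
  then have "i = 0" "j = Suc 0" by auto
  with 0 show ?case by (auto elim!: tuples_SucE)
next
  case (Suc k)
  obtain j' where j: "j = Suc j'" using Suc.prems by (cases j) auto
  show ?case
  proof (cases i)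
    case 0
    with Suc.prems j show ?thesis
      by (auto elim!: tuples_SucE[of Xs] intro: nths_minus_one_in_tuples)
  next
    case (Suc i')
    with Suc.prems j show ?thesis
      by (auto elim!: tuples_SucE[of Xs] intro: Suc.IH)
  qed
qed

section \<open>Alternating multilinear maps\<close>

lemma cochain_outside: "\<phi> \<in> cochains S k \<Longrightarrow> Xs \<notin> tuples S k \<Longrightarrow> \<phi> Xs = 0"
  by (simp add: cochains_def)

lemma cochain_add:
  "\<phi> \<in> cochains S k \<Longrightarrow> Xs \<in> tuples S k \<Longrightarrow> i < k \<Longrightarrow> X \<in> S \<Longrightarrow> Y \<in> S
    \<Longrightarrow> \<phi> (Xs[i := X + Y]) = \<phi> (Xs[i := X]) + \<phi> (Xs[i := Y])"
  by (simp add: cochains_def)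

lemma cochain_scale:
  "\<phi> \<in> cochains S k \<Longrightarrow> Xs \<in> tuples S k \<Longrightarrow> i < k \<Longrightarrow> X \<in> S
    \<Longrightarrow> \<phi> (Xs[i := a *\<^sub>R X]) = a *\<^sub>R \<phi> (Xs[i := X])"
  by (simp add: cochains_def)

lemma cochain_alternating:
  "\<phi> \<in> cochains S k \<Longrightarrow> Xs \<in> tuples S k \<Longrightarrow> i < k \<Longrightarrow> j < k \<Longrightarrow> i \<noteq> j \<Longrightarrow> Xs ! i = Xs ! j
    \<Longrightarrow> \<phi> Xs = 0"
  unfolding cochains_def by blast

lemma cochainI:
  assumes "\<And>Xs. Xs \<notin> tuples S k \<Longrightarrow> \<phi> Xs = 0"
    and "\<And>Xs i X Y. \<lbrakk>Xs \<in> tuples S k; i < k; X \<in> S; Y \<in> S\<rbrakk>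
          \<Longrightarrow> \<phi> (Xs[i := X + Y]) = \<phi> (Xs[i := X]) + \<phi> (Xs[i := Y])"
    and "\<And>Xs i X a. \<lbrakk>Xs \<in> tuples S k; i < k; X \<in> S\<rbrakk>
          \<Longrightarrow> \<phi> (Xs[i := a *\<^sub>R X]) = a *\<^sub>R \<phi> (Xs[i := X])"
    and "\<And>Xs i j. \<lbrakk>Xs \<in> tuples S k; i < k; j < k; i \<noteq> j; Xs ! i = Xs ! j\<rbrakk> \<Longrightarrow> \<phi> Xs = 0"
  shows "\<phi> \<in> cochains S k"
  using assms unfolding cochains_def by blast

lemma cochains_lincomb:
  assumes "\<phi> \<in> cochains S k" "\<psi> \<in> cochains S k"
  shows "(\<lambda>Xs. a *\<^sub>R \<phi> Xs + b *\<^sub>R \<psi> Xs) \<in> cochains S k"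
  by (rule cochainI)
    (auto simp: cochain_outside[OF assms(1)] cochain_outside[OF assms(2)]
      cochain_add[OF assms(1)] cochain_add[OF assms(2)]
      cochain_scale[OF assms(1)] cochain_scale[OF assms(2)] algebra_simps
      cochain_alternating[OF assms(1)] cochain_alternating[OF assms(2)])

lemma cochains_zero: "(\<lambda>Xs. 0) \<in> cochains S k"
  by (simp add: cochains_def)

lemma cochains_scale: "\<phi> \<in> cochains S k \<Longrightarrow> (\<lambda>Xs. a *\<^sub>R \<phi> Xs) \<in> cochains S k"
  using cochains_lincomb[of \<phi> S k \<phi> a 0] by simp

lemma cochains_add:
  "\<phi> \<in> cochains S k \<Longrightarrow> \<psi> \<in> cochains S k \<Longrightarrow> (\<lambda>Xs. \<phi> Xs + \<psi> Xs) \<in> cochains S k"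
  using cochains_lincomb[of \<phi> S k \<psi> 1 1] by simp

lemma cochains_diff:
  "\<phi> \<in> cochains S k \<Longrightarrow> \<psi> \<in> cochains S k \<Longrightarrow> (\<lambda>Xs. \<phi> Xs - \<psi> Xs) \<in> cochains S k"
  using cochains_lincomb[of \<phi> S k \<psi> 1 "-1"] by simp

lemma cochains_sum:
  "(\<And>i. i \<in> I \<Longrightarrow> \<phi> i \<in> cochains S k) \<Longrightarrow> (\<lambda>Xs. \<Sum>i\<in>I. \<phi> i Xs) \<in> cochains S k"
  by (induction I rule: infinite_finite_induct) (auto intro: cochains_zero cochains_add)

lemma cochains_linear_compose:
  assumes "\<phi> \<in> cochains S k" "linear f"
  shows "(\<lambda>Xs. f (\<phi> Xs)) \<in> cochains S k"
proof -
  interpret linear f by fact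
  show ?thesis
    by (rule cochainI)
      (auto simp: cochain_outside[OF assms(1)] cochain_add[OF assms(1)] cochain_scale[OF assms(1)]
        cochain_alternating[OF assms(1)] add scale zero)
qed

lemma cochain_swap:
  assumes \<phi>: "\<phi> \<in> cochains S k" and S: "subspace S" and Xs: "Xs \<in> tuples S k"
    and ij: "i < k" "j < k" "i \<noteq> j"
  shows "\<phi> (Xs[i := Xs ! j, j := Xs ! i]) = - \<phi> Xs"
proof -
  define u where "u X Y = \<phi> (Xs[i := X, j := Y])" for X Y
  let ?x = "Xs ! i" and ?y = "Xs ! j"
  have mem: "?x \<in> S" "?y \<in> S" using Xs ij by (auto intro: tuples_nth)
  then have mem': "?x + ?y \<in> S" using S by (simp add: subspace_add)
  have len: "length Xs = k" using Xs by (rule tuples_length)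
  have diag: "u X X = 0" if "X \<in> S" for X
    unfolding u_def
    by (rule cochain_alternating[OF \<phi> _ ij]) (use that Xs ij len in \<open>auto intro!: tuples_update\<close>)
  have right: "u X (Y + Z) = u X Y + u X Z" if "X \<in> S" "Y \<in> S" "Z \<in> S" for X Y Z
    unfolding u_def by (rule cochain_add[OF \<phi>]) (use that Xs ij in \<open>auto intro!: tuples_update\<close>)
  have left: "u (Y + Z) X = u Y X + u Z X" if "X \<in> S" "Y \<in> S" "Z \<in> S" for X Y Z
    unfolding u_def list_update_swap[OF ij(3)]
    by (rule cochain_add[OF \<phi>]) (use that Xs ij in \<open>auto intro!: tuples_update\<close>)
  have "u (?x + ?y) (?x + ?y) = u ?x ?y + u ?y ?x"
    using mem mem' by (simp add: left right diag[OF mem(1)] diag[OF mem(2)])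
  then have "u ?y ?x = - u ?x ?y"
    using diag[OF mem'] by (simp add: add_eq_0_iff)
  then show ?thesis by (simp add: u_def list_update_id)
qed

lemma cochain_permute:
  assumes \<phi>: "\<phi> \<in> cochains S k" and S: "subspace S" and Xs: "Xs \<in> tuples S k"
    and p: "p permutes {..<k}"
  shows "\<phi> (permute_list p Xs) = of_int (sign p) *\<^sub>R \<phi> Xs"
  using p finite_lessThan[of k] Xs
proof (induction arbitrary: Xs rule: permutes_induct)
  case id
  then show ?case by (simp add: sign_id)
next
  case (swap a b p)
  let ?Ys = "permute_list (Transposition.transpose a b) Xs"
  have len: "length Xs = k" using swap.prems by (rule tuples_length)
  have Ys: "?Ys = Xs[a := Xs ! b, b := Xs ! a]"
    using swap.hyps len
    by (intro nth_equalityI)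
       (auto simp: permute_list_def nth_list_update Transposition.transpose_def)
  have Ys_in: "?Ys \<in> tuples S k"
    unfolding Ys using swap.hyps swap.prems by (auto intro!: tuples_update intro: tuples_nth)
  have "\<phi> (permute_list (Transposition.transpose a b \<circ> p) Xs) = \<phi> (permute_list p ?Ys)"
    using swap.hyps len by (subst permute_list_compose) auto
  also have "\<dots> = of_int (sign p) *\<^sub>R \<phi> ?Ys" using swap.IH Ys_in by blast
  also have "\<phi> ?Ys = - \<phi> Xs"
    unfolding Ys using swap.hyps swap.prems by (intro cochain_swap[OF \<phi> S]) auto
  also have "of_int (sign p) *\<^sub>R - \<phi> Xs = of_int (sign (Transposition.transpose a b \<circ> p)) *\<^sub>R \<phi> Xs"
    using swap.hyps
    by (simp add: sign_compose sign_swap_id permutation_swap_id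
        permutation_permutes[THEN iffD2] exI[of _ "{..<k}"] permutes_imp_permutation)
  finally show ?case .
qed

definition contraction :: "'h \<Rightarrow> ('h list \<Rightarrow> 'h) \<Rightarrow> 'h list \<Rightarrow> 'h" where
  "contraction X \<phi> Xs = \<phi> (X # Xs)"

lemma contraction_in_cochains:
  assumes \<phi>: "\<phi> \<in> cochains S (Suc k)" and X: "X \<in> S"
  shows "contraction X \<phi> \<in> cochains S k"
proof (rule cochainI)
  fix Xs assume "Xs \<notin> tuples S k"
  then show "contraction X \<phi> Xs = 0"
    by (simp add: contraction_def cochain_outside[OF \<phi>])
next
  fix Xs i Y Z assume "Xs \<in> tuples S k" "i < k" "Y \<in> S" "Z \<in> S"
  then show "contraction X \<phi> (Xs[i := Y + Z]) =
    contraction X \<phi> (Xs[i := Y]) + contraction X \<phi> (Xs[i := Z])"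
    using cochain_add[OF \<phi>, of "X # Xs" "Suc i" Y Z] X by (simp add: contraction_def)
next
  fix Xs i Y a assume "Xs \<in> tuples S k" "i < k" "Y \<in> S"
  then show "contraction X \<phi> (Xs[i := a *\<^sub>R Y]) = a *\<^sub>R contraction X \<phi> (Xs[i := Y])"
    using cochain_scale[OF \<phi>, of "X # Xs" "Suc i" Y a] X by (simp add: contraction_def)
next
  fix Xs i j assume "Xs \<in> tuples S k" "i < k" "j < k" "i \<noteq> j" "Xs ! i = Xs ! j"
  then show "contraction X \<phi> Xs = 0"
    using cochain_alternating[OF \<phi>, of "X # Xs" "Suc i" "Suc j"] X by (simp add: contraction_def)
qed

lemma cochain_Cons_add:
  assumes "\<phi> \<in> cochains S (Suc k)" "X \<in> S" "Y \<in> S" "Xs \<in> tuples S k"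
  shows "\<phi> ((X + Y) # Xs) = \<phi> (X # Xs) + \<phi> (Y # Xs)"
  using cochain_add[OF assms(1), of "X # Xs" 0 X Y] assms by simp

lemma cochain_Cons_scale:
  assumes "\<phi> \<in> cochains S (Suc k)" "X \<in> S" "Xs \<in> tuples S k"
  shows "\<phi> ((a *\<^sub>R X) # Xs) = a *\<^sub>R \<phi> (X # Xs)"
  using cochain_scale[OF assms(1), of "X # Xs" 0 X a] assms by simp

lemma cochain_Cons_swap:
  assumes "\<phi> \<in> cochains S (Suc (Suc k))" "subspace S" "X \<in> S" "Y \<in> S" "Xs \<in> tuples S k"
  shows "\<phi> (Y # X # Xs) = - \<phi> (X # Y # Xs)"
  using cochain_swap[OF assms(1,2), of "X # Y # Xs" 0 1] assms by simp

text \<open>Recursion on the degree: a map is alternating and multilinear as soon as its contractions are and it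
  behaves well in the first argument.  Only repetitions in the first two places have to be excluded by
  hand, since the contractions allow a repeated later entry to be moved to the second place.\<close>

lemma cochainI_Cons:
  assumes S: "subspace S"
    and outside: "\<And>Xs. Xs \<notin> tuples S (Suc k) \<Longrightarrow> \<phi> Xs = 0"
    and contr: "\<And>X. X \<in> S \<Longrightarrow> contraction X \<phi> \<in> cochains S k"
    and add: "\<And>X Y Xs. \<lbrakk>X \<in> S; Y \<in> S; Xs \<in> tuples S k\<rbrakk>
          \<Longrightarrow> \<phi> ((X + Y) # Xs) = \<phi> (X # Xs) + \<phi> (Y # Xs)"
    and scale: "\<And>X a Xs. \<lbrakk>X \<in> S; Xs \<in> tuples S k\<rbrakk> \<Longrightarrow> \<phi> ((a *\<^sub>R X) # Xs) = a *\<^sub>R \<phi> (X # Xs)"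
    and alt: "\<And>X Xs. \<lbrakk>X \<in> S; X # Xs \<in> tuples S k\<rbrakk> \<Longrightarrow> \<phi> (X # X # Xs) = 0"
  shows "\<phi> \<in> cochains S (Suc k)"
proof -
  have alt0: "\<phi> (X # Xs) = 0" if X: "X \<in> S" and Xs: "Xs \<in> tuples S k" and j: "j < k" "Xs ! j = X" for X Xs j
  proof (cases j)
    case 0
    with Xs j obtain k' Ys where "Xs = X # Ys"
      by (cases Xs) (auto simp: tuples_def)
    with alt X Xs show ?thesis by simp
  next
    case (Suc j')
    \<comment> \<open>Moving the repeated entry next to the first one changes only the sign.\<close>
    let ?Ys = "Xs[0 := Xs ! j, j := Xs ! 0]"
    have "length Xs = k" using Xs by (rule tuples_length)
    then obtain Zs where Zs: "?Ys = X # Zs"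
      using Suc j by (cases Xs) auto
    have Ys_in: "?Ys \<in> tuples S k" using Xs j by (auto intro!: tuples_update intro: tuples_nth)
    have "contraction X \<phi> ?Ys = - contraction X \<phi> Xs"
      using Suc j Xs by (intro cochain_swap[OF contr[OF X] S]) auto
    moreover have "contraction X \<phi> ?Ys = 0"
      unfolding Zs contraction_def using alt X Ys_in Zs by simp
    ultimately show ?thesis by (simp add: contraction_def)
  qed
  show ?thesis
  proof (rule cochainI)
    fix Xs assume "Xs \<notin> tuples S (Suc k)" then show "\<phi> Xs = 0" by (rule outside)
  next
    fix Xs i Y Z assume Xs: "Xs \<in> tuples S (Suc k)" and "i < Suc k" "Y \<in> S" "Z \<in> S"
    then show "\<phi> (Xs[i := Y + Z]) = \<phi> (Xs[i := Y]) + \<phi> (Xs[i := Z])"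
      by (cases i; elim tuples_SucE)
        (use add cochain_add[OF contr] in \<open>auto simp: contraction_def\<close>)
  next
    fix Xs i Y a assume Xs: "Xs \<in> tuples S (Suc k)" and "i < Suc k" "Y \<in> S"
    then show "\<phi> (Xs[i := a *\<^sub>R Y]) = a *\<^sub>R \<phi> (Xs[i := Y])"
      by (cases i; elim tuples_SucE)
        (use scale cochain_scale[OF contr] in \<open>auto simp: contraction_def\<close>)
  next
    fix Xs i j assume Xs: "Xs \<in> tuples S (Suc k)" and ij: "i < Suc k" "j < Suc k" "i \<noteq> j" "Xs ! i = Xs ! j"
    from Xs obtain X Ys where X: "Xs = X # Ys" "X \<in> S" "Ys \<in> tuples S k" by (rule tuples_SucE)
    show "\<phi> Xs = 0"
    proof (cases "i = 0 \<or> j = 0")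
      case True
      then show ?thesis
        using ij X alt0[of X Ys "i - 1"] alt0[of X Ys "j - 1"] by (auto simp: nth_Cons')
    next
      case False
      then have "contraction X \<phi> Ys = 0"
        using ij X by (intro cochain_alternating[OF contr[OF X(2)] X(3), of "i - 1" "j - 1"]) auto
      then show ?thesis by (simp add: contraction_def X)
    qed
  qed
qed

text \<open>The sign of the cyclic permutation that brings the entry at position \<open>j\<close> to the front.  In Cartan's
  formula this identifies the terms \<open>\<omega>([X, X\<^sub>j], \<dots>)\<close> of the differential with those of the Lie
  derivative, where the bracket replaces \<open>X\<^sub>j\<close> in its place.\<close>

lemma cochain_move_to_front:
  assumes S: "subspace S" and Y: "Y \<in> S"
  shows "\<phi> \<in> cochains S (Suc k) \<Longrightarrow> Xs \<in> tuples S (Suc k) \<Longrightarrow> j \<le> k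
    \<Longrightarrow> \<phi> (Xs[j := Y]) = (- 1) ^ j *\<^sub>R \<phi> (Y # nths Xs (- {j}))"
proof (induction j arbitrary: \<phi> k Xs)
  case 0
  then show ?case by (auto elim!: tuples_SucE)
next
  case (Suc j)
  then obtain k' where k: "k = Suc k'" by (cases k) auto
  from Suc.prems obtain X Ys where X: "Xs = X # Ys" "X \<in> S" "Ys \<in> tuples S k"
    by (auto elim: tuples_SucE)
  have nths: "nths Ys (- {j}) \<in> tuples S k'"
    using X Suc.prems k by (auto intro: nths_minus_one_in_tuples)
  have "\<phi> (Xs[Suc j := Y]) = contraction X \<phi> (Ys[j := Y])" by (simp add: X contraction_def)
  also have "\<dots> = (- 1) ^ j *\<^sub>R contraction X \<phi> (Y # nths Ys (- {j}))"
    using contraction_in_cochains[OF Suc.prems(1) X(2)] X Suc.prems k by (intro Suc.IH) auto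
  also have "contraction X \<phi> (Y # nths Ys (- {j})) = - \<phi> (Y # X # nths Ys (- {j}))"
    using cochain_Cons_swap[OF Suc.prems(1)[unfolded k] S Y X(2) nths] by (simp add: contraction_def)
  finally show ?case by (simp add: X)
qed

text \<open>If two entries at \<open>p\<close> and \<open>q\<close> agree, all terms with \<open>i\<close> different from \<open>p\<close> and \<open>q\<close> still contain the
  repetition, and the two remaining ones differ by a transposition.\<close>

lemma cochains_derivation:
  assumes \<phi>: "\<phi> \<in> cochains S k" and S: "subspace S"
    and D: "linear D" "\<And>X. X \<in> S \<Longrightarrow> D X \<in> S"
  shows "(\<lambda>Xs. if Xs \<in> tuples S k then \<Sum>i<k. \<phi> (Xs[i := D (Xs ! i)]) else 0) \<in> cochains S k"
proof -
  interpret D: linear D by fact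
  let ?d = "\<lambda>Xs. \<Sum>i<k. \<phi> (Xs[i := D (Xs ! i)])"
  have split: "?d (Xs[m := Y]) =
      \<phi> (Xs[m := D Y]) + (\<Sum>i\<in>{..<k} - {m}. \<phi> (Xs[i := D (Xs ! i), m := Y]))"
    if "Xs \<in> tuples S k" "m < k" for Xs m Y
  proof -
    have "?d (Xs[m := Y]) = \<phi> (Xs[m := D Y]) + (\<Sum>i\<in>{..<k} - {m}. \<phi> (Xs[m := Y, i := D (Xs[m := Y] ! i)]))"
      using that by (subst sum.remove[of _ m]) (auto simp: tuples_length)
    also have "(\<Sum>i\<in>{..<k} - {m}. \<phi> (Xs[m := Y, i := D (Xs[m := Y] ! i)])) =
        (\<Sum>i\<in>{..<k} - {m}. \<phi> (Xs[i := D (Xs ! i), m := Y]))"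
      by (rule sum.cong) (auto intro!: arg_cong[where f = \<phi>] list_update_swap)
    finally show ?thesis .
  qed
  have upd: "Xs[i := D (Xs ! i)] \<in> tuples S k" if "Xs \<in> tuples S k" "i < k" for Xs i
    using that by (auto intro!: tuples_update D intro: tuples_nth)
  show ?thesis
  proof (rule cochainI, goal_cases)
    case (1 Xs)
    then show ?case by simp
  next
    case (2 Xs i X Y)
    then show ?case
      using S D(2)
      by (auto simp: tuples_update subspace_add split D.add cochain_add[OF \<phi>] upd sum.distrib)
  next
    case (3 Xs i X a)
    then show ?case
      using S D(2)
      by (auto simp: tuples_update subspace_scale split D.scale cochain_scale[OF \<phi>] upd
          scaleR_sum_right scaleR_add_right)
  next
    case (4 Xs p q)
    have len: "length Xs = k" using 4 by (simp add: tuples_length)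
    have "?d Xs = (\<Sum>i\<in>{p, q}. \<phi> (Xs[i := D (Xs ! i)]))"
    proof (rule sum.mono_neutral_right)
      show "\<forall>i\<in>{..<k} - {p, q}. \<phi> (Xs[i := D (Xs ! i)]) = 0"
        using 4 by (auto intro!: cochain_alternating[OF \<phi> upd, of _ _ p q])
    qed (use 4 in auto)
    also have "\<dots> = \<phi> (Xs[p := D (Xs ! p)]) + \<phi> (Xs[q := D (Xs ! p)])"
      using 4 by simp
    also have "Xs[q := D (Xs ! p)] =
        Xs[p := D (Xs ! p), p := Xs[p := D (Xs ! p)] ! q, q := Xs[p := D (Xs ! p)] ! p]"
      using 4 len by (auto intro!: nth_equalityI simp: nth_list_update)
    also have "\<phi> \<dots> = - \<phi> (Xs[p := D (Xs ! p)])"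
      using 4 by (intro cochain_swap[OF \<phi> S upd]) auto
    finally show ?case using 4 by simp
  qed
qed

section \<open>The differential is alternating\<close>

definition lie_derivative ::
  "('h::real_vector \<Rightarrow> 'h \<Rightarrow> 'h) \<Rightarrow> 'h set \<Rightarrow> nat \<Rightarrow> 'h \<Rightarrow> ('h list \<Rightarrow> 'h) \<Rightarrow> 'h list \<Rightarrow> 'h" where
  "lie_derivative br S k X \<omega> Xs =
     (if Xs \<in> tuples S k then br X (\<omega> Xs) - (\<Sum>i<k. \<omega> (Xs[i := br X (Xs ! i)])) else 0)"

locale lie_algebra_with_subalgebra = lie_algebra br
  for br :: "'h::real_vector \<Rightarrow> 'h \<Rightarrow> 'h" +
  fixes S :: "'h set"
  assumes subspace: "subspace S"
    and closed: "X \<in> S \<Longrightarrow> Y \<in> S \<Longrightarrow> br X Y \<in> S"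
begin

lemma linear_br_right: "linear (br X)"
  by (rule linearI) (simp_all add: add_right scale_right)

lemma lie_derivative_in_cochains:
  assumes "\<omega> \<in> cochains S k" "X \<in> S"
  shows "lie_derivative br S k X \<omega> \<in> cochains S k"
proof -
  have zero: "br X 0 = 0" using linear_br_right[of X] by (simp add: linear_0)
  have "(\<lambda>Xs. br X (\<omega> Xs) -
      (if Xs \<in> tuples S k then \<Sum>i<k. \<omega> (Xs[i := br X (Xs ! i)]) else 0)) \<in> cochains S k"
    by (rule cochains_diff[OF cochains_linear_compose[OF assms(1) linear_br_right]
          cochains_derivation[OF assms(1) subspace linear_br_right closed[OF assms(2)]]])
  also have "(\<lambda>Xs. br X (\<omega> Xs) -
      (if Xs \<in> tuples S k then \<Sum>i<k. \<omega> (Xs[i := br X (Xs ! i)]) else 0)) = lie_derivative br S k X \<omega>"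
    by (rule ext) (simp add: lie_derivative_def cochain_outside[OF assms(1)] zero)
  finally show ?thesis .
qed

text \<open>Cartan's formula \<open>\<iota>\<^sub>X \<partial>\<omega> = L\<^sub>X \<omega> - \<partial> \<iota>\<^sub>X \<omega>\<close>: the summands of \<open>\<partial>\<omega>(X, X\<^sub>1, \<dots>)\<close> with an index pointing at \<open>X\<close> make up
  the Lie derivative, and the others are those of \<open>\<partial> \<iota>\<^sub>X \<omega>\<close> with opposite sign: the single sum because its
  index is shifted by one, the double sum because \<open>X\<close> has to be exchanged with the bracket.\<close>

lemma differential_Cons:
  assumes \<omega>: "\<omega> \<in> cochains S (Suc k)" and X: "X \<in> S" and Xs: "Xs \<in> tuples S (Suc k)"
  shows "differential br S (Suc k) \<omega> (X # Xs) =
    lie_derivative br S (Suc k) X \<omega> Xs - differential br S k (contraction X \<omega>) Xs"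
proof -
  have swap: "\<omega> (br (Xs ! i) (Xs ! j) # X # nths Xs (- {i, j})) =
      - contraction X \<omega> (br (Xs ! i) (Xs ! j) # nths Xs (- {i, j}))"
    if ij: "i < j" "j \<le> k" for i j
  proof -
    obtain k' where k: "k = Suc k'" using ij by (cases k) auto
    have "Xs ! i \<in> S" "Xs ! j \<in> S" using ij Xs by (auto intro: tuples_nth)
    moreover have "nths Xs (- {i, j}) \<in> tuples S k'"
      using ij Xs k by (auto intro: nths_minus_two_in_tuples)
    ultimately show ?thesis
      using cochain_Cons_swap[OF \<omega>[unfolded k] subspace X] closed by (simp add: contraction_def)
  qed
  have front: "(- 1) ^ j *\<^sub>R \<omega> (br X (Xs ! j) # nths Xs (- {j})) = \<omega> (Xs[j := br X (Xs ! j)])"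
    if "j \<le> k" for j
    using that X Xs by (intro cochain_move_to_front[OF subspace _ \<omega> Xs, symmetric] closed tuples_nth[OF Xs]) auto
  have "differential br S (Suc k) \<omega> (X # Xs) =
     br X (\<omega> Xs) - (\<Sum>i\<le>k. (- 1) ^ i *\<^sub>R br (Xs ! i) (\<omega> (X # nths Xs (- {i})))) +
     ((\<Sum>j\<le>k. - ((- 1) ^ j *\<^sub>R \<omega> (br X (Xs ! j) # nths Xs (- {j})))) +
      (\<Sum>j\<le>k. \<Sum>i<j. (- 1) ^ (i + j) *\<^sub>R \<omega> (br (Xs ! i) (Xs ! j) # X # nths Xs (- {i, j}))))"
    using X Xs
    by (simp add: differential_def sum.atMost_Suc_shift[of _ k] sum.lessThan_Suc_shift
        sum.distrib sum_negf sum_subtractf del: sum.atMost_Suc sum.lessThan_Suc)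
  also have "(\<Sum>j\<le>k. - ((- 1) ^ j *\<^sub>R \<omega> (br X (Xs ! j) # nths Xs (- {j})))) =
      - (\<Sum>j<Suc k. \<omega> (Xs[j := br X (Xs ! j)]))"
    unfolding lessThan_Suc_atMost sum_negf[symmetric] by (rule sum.cong) (simp_all add: front)
  also have "(\<Sum>j\<le>k. \<Sum>i<j. (- 1) ^ (i + j) *\<^sub>R \<omega> (br (Xs ! i) (Xs ! j) # X # nths Xs (- {i, j}))) =
      - (\<Sum>j\<le>k. \<Sum>i<j. (- 1) ^ (i + j) *\<^sub>R
          contraction X \<omega> (br (Xs ! i) (Xs ! j) # nths Xs (- {i, j})))"
    unfolding sum_negf[symmetric] by (intro sum.cong refl) (simp add: swap)
  finally show ?thesis
    using Xs by (simp add: lie_derivative_def differential_def contraction_def algebra_simps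
        del: sum.lessThan_Suc)
qed

lemma differential_add:
  "differential br S k (\<lambda>Xs. \<phi> Xs + \<psi> Xs) Xs = differential br S k \<phi> Xs + differential br S k \<psi> Xs"
  by (simp add: differential_def add_right scaleR_add_right sum.distrib)

lemma differential_scale:
  "differential br S k (\<lambda>Xs. a *\<^sub>R \<phi> Xs) Xs = a *\<^sub>R differential br S k \<phi> Xs"
  by (simp add: differential_def scale_right scaleR_add_right scaleR_sum_right mult.commute)

lemma differential_cong:
  assumes "\<And>Xs. Xs \<in> tuples S k \<Longrightarrow> \<phi> Xs = \<psi> Xs"
  shows "differential br S k \<phi> Xs = differential br S k \<psi> Xs"
proof -
  have "\<phi> (nths Xs (- {i})) = \<psi> (nths Xs (- {i}))" if "Xs \<in> tuples S (Suc k)" "i \<le> k" for i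
    using that by (intro assms nths_minus_one_in_tuples)
  moreover have "\<phi> (br (Xs ! i) (Xs ! j) # nths Xs (- {i, j})) = \<psi> (br (Xs ! i) (Xs ! j) # nths Xs (- {i, j}))"
    if ij: "Xs \<in> tuples S (Suc k)" "i < j" "j \<le> k" for i j
  proof -
    obtain k' where k: "k = Suc k'" using ij by (cases k) auto
    show ?thesis using ij
      by (intro assms) (auto simp: k intro!: nths_minus_two_in_tuples closed tuples_nth)
  qed
  ultimately show ?thesis by (simp add: differential_def)
qed

text \<open>By Cartan's formula the contractions of \<open>\<partial>\<omega>\<close> are cochains if \<open>\<partial>\<close> maps to cochains one degree lower.
  The remaining condition \<open>\<iota>\<^sub>X \<iota>\<^sub>X \<partial>\<omega> = 0\<close> is Cartan's formula used twice, because
  \<open>\<iota>\<^sub>X \<iota>\<^sub>X \<omega> = 0\<close> and \<open>\<iota>\<^sub>X\<close> commutes with \<open>L\<^sub>X\<close>.\<close>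

theorem differential_in_cochains:
  "\<omega> \<in> cochains S k \<Longrightarrow> differential br S k \<omega> \<in> cochains S (Suc k)"
proof (induction k arbitrary: \<omega>)
  case 0
  show ?case
  proof (rule cochainI_Cons[OF subspace])
    show "contraction X (differential br S 0 \<omega>) \<in> cochains S 0" for X
      by (auto simp: cochains_def contraction_def differential_def tuples_def)
  qed (auto simp: differential_def add_left scale_left subspace_add[OF subspace] subspace_scale[OF subspace])
next
  case (Suc k)
  note \<omega> = Suc.prems
  have contr: "contraction X \<omega> \<in> cochains S k" if "X \<in> S" for X
    using \<omega> that by (rule contraction_in_cochains)
  show ?case
  proof (rule cochainI_Cons[OF subspace])
    fix X assume X: "X \<in> S"
    have "contraction X (differential br S (Suc k) \<omega>) =
        (\<lambda>Xs. lie_derivative br S (Suc k) X \<omega> Xs - differential br S k (contraction X \<omega>) Xs)"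
    proof
      fix Xs
      show "contraction X (differential br S (Suc k) \<omega>) Xs =
        lie_derivative br S (Suc k) X \<omega> Xs - differential br S k (contraction X \<omega>) Xs"
      proof (cases "Xs \<in> tuples S (Suc k)")
        case True
        then show ?thesis using differential_Cons[OF \<omega> X] by (simp add: contraction_def)
      next
        case False
        then show ?thesis by (simp add: contraction_def lie_derivative_def differential_def)
      qed
    qed
    also have "\<dots> \<in> cochains S (Suc k)"
      by (rule cochains_diff[OF lie_derivative_in_cochains[OF \<omega> X] Suc.IH[OF contr[OF X]]])
    finally show "contraction X (differential br S (Suc k) \<omega>) \<in> cochains S (Suc k)" .
  next
    fix X Y Xs assume *: "X \<in> S" "Y \<in> S" "Xs \<in> tuples S (Suc k)"
    have "lie_derivative br S (Suc k) (X + Y) \<omega> Xs =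
        lie_derivative br S (Suc k) X \<omega> Xs + lie_derivative br S (Suc k) Y \<omega> Xs"
      using * by (simp add: lie_derivative_def add_left cochain_add[OF \<omega>] closed tuples_nth sum.distrib
          del: sum.lessThan_Suc)
    moreover have "differential br S k (contraction (X + Y) \<omega>) Xs =
        differential br S k (contraction X \<omega>) Xs + differential br S k (contraction Y \<omega>) Xs"
      unfolding differential_add[symmetric]
      by (rule differential_cong) (use * cochain_Cons_add[OF \<omega>] in \<open>simp add: contraction_def\<close>)
    ultimately show "differential br S (Suc k) \<omega> ((X + Y) # Xs) =
        differential br S (Suc k) \<omega> (X # Xs) + differential br S (Suc k) \<omega> (Y # Xs)"
      using * subspace by (simp add: differential_Cons[OF \<omega>] subspace_add)
  next
    fix X a Xs assume *: "X \<in> S" "Xs \<in> tuples S (Suc k)"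
    have "lie_derivative br S (Suc k) (a *\<^sub>R X) \<omega> Xs = a *\<^sub>R lie_derivative br S (Suc k) X \<omega> Xs"
      using * by (simp add: lie_derivative_def scale_left cochain_scale[OF \<omega>] closed tuples_nth
          scaleR_sum_right scaleR_diff_right del: sum.lessThan_Suc)
    moreover have "differential br S k (contraction (a *\<^sub>R X) \<omega>) Xs =
        a *\<^sub>R differential br S k (contraction X \<omega>) Xs"
      unfolding differential_scale[symmetric]
      by (rule differential_cong) (use * cochain_Cons_scale[OF \<omega>] in \<open>simp add: contraction_def\<close>)
    ultimately show "differential br S (Suc k) \<omega> ((a *\<^sub>R X) # Xs) = a *\<^sub>R differential br S (Suc k) \<omega> (X # Xs)"
      using * subspace by (simp add: differential_Cons[OF \<omega>] subspace_scale scaleR_diff_right)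
  next
    fix X Xs assume X: "X \<in> S" and XXs: "X # Xs \<in> tuples S (Suc k)"
    then have Xs: "Xs \<in> tuples S k" by simp
    have "differential br S k (contraction X \<omega>) (X # Xs) = lie_derivative br S k X (contraction X \<omega>) Xs"
    proof (cases k)
      case 0
      then show ?thesis using X Xs by (simp add: differential_def lie_derivative_def)
    next
      case (Suc k')
      have "contraction X (contraction X \<omega>) Ys = 0" if "Ys \<in> tuples S k'" for Ys
        unfolding contraction_def
        by (rule cochain_alternating[OF \<omega>, of _ 0 1]) (use that X Suc in auto)
      then have "differential br S k' (contraction X (contraction X \<omega>)) Xs = differential br S k' (\<lambda>_. 0) Xs"
        by (rule differential_cong)
      also have "\<dots> = 0" using differential_scale[of k' 0 "\<lambda>_. 0" Xs] by simp
      finally show ?thesis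
        using X Xs contr[OF X] differential_Cons[of "contraction X \<omega>" k' X Xs] Suc by simp
    qed
    moreover have "lie_derivative br S (Suc k) X \<omega> (X # Xs) = lie_derivative br S k X (contraction X \<omega>) Xs"
    proof -
      have "\<omega> (0 # Xs) = 0" using cochain_Cons_scale[OF \<omega> X Xs, of 0] by simp
      then show ?thesis
        using X Xs by (simp add: lie_derivative_def contraction_def alternating sum.lessThan_Suc_shift
            del: sum.lessThan_Suc)
    qed
    ultimately show "differential br S (Suc k) \<omega> (X # X # Xs) = 0"
      using X XXs differential_Cons[OF \<omega> X XXs] by simp
  qed (simp add: differential_def)
qed

end

section \<open>The induced metric\<close>

text \<open>The expansion formula of orthonormal bases, taken as a definition; families of vectors with this property
  are known as Parseval frames.\<close>

locale parseval_frame =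
  fixes S E :: "'h::euclidean_space set"
  assumes frame_subspace: "subspace S"
    and frame_finite: "finite E"
    and frame_subset: "E \<subseteq> S"
    and frame_expansion: "X \<in> S \<Longrightarrow> (\<Sum>e\<in>E. inner e X *\<^sub>R e) = X"
begin

lemma finite_tuples: "finite (tuples E k)"
  unfolding tuples_def using finite_lists_length_eq[OF frame_finite, of k]
  by (simp add: conj_commute)

lemma tuples_frame: "Es \<in> tuples E k \<Longrightarrow> Es \<in> tuples S k"
  using frame_subset by (auto simp: tuples_def)

lemma sum_tuples_Suc: "(\<Sum>Es\<in>tuples E (Suc k). f Es) = (\<Sum>e\<in>E. \<Sum>Es\<in>tuples E k. f (e # Es))"
proof -
  have "bij_betw (\<lambda>(e, Es). e # Es) (E \<times> tuples E k) (tuples E (Suc k))"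
    by (auto simp: bij_betw_def inj_on_def elim!: tuples_SucE)
  from sum.reindex_bij_betw[OF this, of f] show ?thesis
    by (simp add: sum.cartesian_product case_prod_unfold)
qed

lemma cochain_Cons_sum:
  assumes \<phi>: "\<phi> \<in> cochains S (Suc k)" and Xs: "Xs \<in> tuples S k"
    and J: "finite J" "\<And>a. a \<in> J \<Longrightarrow> f a \<in> S"
  shows "\<phi> ((\<Sum>a\<in>J. c a *\<^sub>R f a) # Xs) = (\<Sum>a\<in>J. c a *\<^sub>R \<phi> (f a # Xs))"
  using J
proof (induction J rule: finite_induct)
  case empty
  have "0 \<in> S" using frame_subspace by (rule subspace_0)
  with cochain_Cons_scale[OF \<phi> _ Xs, of 0 0] show ?case by simp
next
  case (insert a J)
  then have "f a \<in> S" "(\<Sum>a\<in>J. c a *\<^sub>R f a) \<in> S"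
    using frame_subspace by (auto intro!: subspace_sum subspace_scale)
  with insert show ?case
    using frame_subspace Xs
    by (simp add: cochain_Cons_add[OF \<phi>] cochain_Cons_scale[OF \<phi>] subspace_scale)
qed

lemma cochain_expansion:
  "\<phi> \<in> cochains S k \<Longrightarrow> Xs \<in> tuples S k
    \<Longrightarrow> \<phi> Xs = (\<Sum>Es\<in>tuples E k. (\<Prod>j<k. inner (Es ! j) (Xs ! j)) *\<^sub>R \<phi> Es)"
proof (induction k arbitrary: \<phi> Xs)
  case 0
  then show ?case by simp
next
  case (Suc k)
  from Suc.prems obtain X Ys where X: "Xs = X # Ys" "X \<in> S" "Ys \<in> tuples S k"
    by (auto elim: tuples_SucE)
  have "\<phi> Xs = \<phi> ((\<Sum>e\<in>E. inner e X *\<^sub>R e) # Ys)" using X frame_expansion by simp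
  also have "\<dots> = (\<Sum>e\<in>E. inner e X *\<^sub>R \<phi> (e # Ys))"
    using frame_subset frame_finite X by (intro cochain_Cons_sum[OF Suc.prems(1)]) auto
  also have "\<dots> = (\<Sum>e\<in>E. inner e X *\<^sub>R
      (\<Sum>Es\<in>tuples E k. (\<Prod>j<k. inner (Es ! j) (Ys ! j)) *\<^sub>R \<phi> (e # Es)))"
  proof (intro sum.cong refl arg_cong2[where f = scaleR])
    fix e assume "e \<in> E"
    then have "contraction e \<phi> \<in> cochains S k"
      using Suc.prems frame_subset by (auto intro: contraction_in_cochains)
    from Suc.IH[OF this X(3)]
    show "\<phi> (e # Ys) = (\<Sum>Es\<in>tuples E k. (\<Prod>j<k. inner (Es ! j) (Ys ! j)) *\<^sub>R \<phi> (e # Es))"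
      by (simp add: contraction_def)
  qed
  also have "\<dots> = (\<Sum>Es\<in>tuples E (Suc k). (\<Prod>j<Suc k. inner (Es ! j) (Xs ! j)) *\<^sub>R \<phi> Es)"
    by (simp add: sum_tuples_Suc X scaleR_sum_right prod.lessThan_Suc_shift del: prod.lessThan_Suc)
  finally show ?case .
qed

text \<open>Expand the determinant by permutations of its rows.  For a fixed permutation \<open>p\<close>, the sum over the tuples
  is the multilinear expansion of \<open>\<phi>\<close> at the permuted arguments, hence \<open>sgn p \<cdot> \<phi> Xs\<close>, and this sign cancels the
  one in the determinant.  Both the key property of the metric and the spanning property of
  decomposable cochains are instances.\<close>

lemma sum_frame_det:
  assumes \<phi>: "\<phi> \<in> cochains S k" and Xs: "Xs \<in> tuples S k"
  shows "(\<Sum>Es\<in>tuples E k.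
      Determinant.det (Matrix.mat k k (\<lambda>(i, j). inner (Xs ! i) (Es ! j))) *\<^sub>R \<phi> Es) = fact k *\<^sub>R \<phi> Xs"
proof -
  let ?P = "{p. p permutes {..<k}}"
  have len: "length Xs = k" using Xs by (rule tuples_length)
  have "(\<Sum>Es\<in>tuples E k.
      Determinant.det (Matrix.mat k k (\<lambda>(i, j). inner (Xs ! i) (Es ! j))) *\<^sub>R \<phi> Es) =
    (\<Sum>Es\<in>tuples E k. \<Sum>p\<in>?P. of_int (sign p) *\<^sub>R
      ((\<Prod>j<k. inner (Es ! j) (permute_list p Xs ! j)) *\<^sub>R \<phi> Es))"
  proof (rule sum.cong[OF refl])
    fix Es
    let ?M = "Matrix.mat k k (\<lambda>(i, j). inner (Xs ! i) (Es ! j))"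
    have "Determinant.det ?M = (\<Sum>p\<in>?P. of_int (sign p) * (\<Prod>j<k. ?M $$ (p j, j)))"
      using det_col[of ?M k] by (simp add: lessThan_atLeast0)
    also have "\<dots> = (\<Sum>p\<in>?P. of_int (sign p) * (\<Prod>j<k. inner (Es ! j) (permute_list p Xs ! j)))"
    proof (intro sum.cong prod.cong refl arg_cong2[where f = "(*)"])
      fix p j assume "p \<in> ?P" "j \<in> {..<k}"
      then have "p j < k" "j < k" using permutes_in_image[of p "{..<k}" j] by auto
      with \<open>p \<in> ?P\<close> show "?M $$ (p j, j) = inner (Es ! j) (permute_list p Xs ! j)"
        using len by (simp add: permute_list_nth inner_commute)
    qed
    finally show "Determinant.det ?M *\<^sub>R \<phi> Es = (\<Sum>p\<in>?P. of_int (sign p) *\<^sub>R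
      ((\<Prod>j<k. inner (Es ! j) (permute_list p Xs ! j)) *\<^sub>R \<phi> Es))"
      by (simp add: scaleR_sum_left)
  qed
  also have "\<dots> = (\<Sum>p\<in>?P. of_int (sign p) *\<^sub>R
      (\<Sum>Es\<in>tuples E k. (\<Prod>j<k. inner (Es ! j) (permute_list p Xs ! j)) *\<^sub>R \<phi> Es))"
    by (subst sum.swap) (simp add: scaleR_sum_right)
  also have "\<dots> = (\<Sum>p\<in>?P. \<phi> Xs)"
  proof (rule sum.cong[OF refl])
    fix p assume "p \<in> ?P"
    then have p: "p permutes {..<k}" by simp
    have "permute_list p Xs \<in> tuples S k"
      using Xs p len by (auto simp: tuples_def)
    then have "(\<Sum>Es\<in>tuples E k. (\<Prod>j<k. inner (Es ! j) (permute_list p Xs ! j)) *\<^sub>R \<phi> Es) =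
        \<phi> (permute_list p Xs)"
      by (rule cochain_expansion[OF \<phi>, symmetric])
    also have "\<dots> = of_int (sign p) *\<^sub>R \<phi> Xs"
      by (rule cochain_permute[OF \<phi> frame_subspace Xs p])
    finally show "of_int (sign p) *\<^sub>R
        (\<Sum>Es\<in>tuples E k. (\<Prod>j<k. inner (Es ! j) (permute_list p Xs ! j)) *\<^sub>R \<phi> Es) = \<phi> Xs"
      by (simp add: sign_def)
  qed
  also have "\<dots> = fact k *\<^sub>R \<phi> Xs"
    using card_permutations[of "{..<k}" k] by (simp add: sum_constant_scaleR)
  finally show ?thesis .
qed

end

text \<open>Linearity is only demanded on \<open>S\<close>, since maps such as \<open>Ad_neg\<close> matter only there.\<close>

definition endomorphism_on :: "'h::real_vector set \<Rightarrow> ('h \<Rightarrow> 'h) \<Rightarrow> bool" where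
  "endomorphism_on S f \<longleftrightarrow> (\<forall>X\<in>S. f X \<in> S) \<and>
     (\<forall>X\<in>S. \<forall>Y\<in>S. f (X + Y) = f X + f Y) \<and> (\<forall>a. \<forall>X\<in>S. f (a *\<^sub>R X) = a *\<^sub>R f X)"

lemma wedge_tensor_cong:
  assumes "length \<alpha>s = length \<beta>s"
    and "\<And>i X. i < length \<alpha>s \<Longrightarrow> X \<in> S \<Longrightarrow> (\<alpha>s ! i) X = (\<beta>s ! i) X"
  shows "wedge_tensor S \<alpha>s V = wedge_tensor S \<beta>s V"
proof
  fix Xs
  have "Matrix.mat (length \<alpha>s) (length \<alpha>s) (\<lambda>(i, j). (\<alpha>s ! i) (Xs ! j)) =
      Matrix.mat (length \<beta>s) (length \<beta>s) (\<lambda>(i, j). (\<beta>s ! i) (Xs ! j))"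
    if "Xs \<in> tuples S (length \<alpha>s)"
    using assms that by (intro cong_mat) (auto intro!: assms(2) tuples_nth)
  with assms(1) show "wedge_tensor S \<alpha>s V Xs = wedge_tensor S \<beta>s V Xs"
    by (simp add: wedge_tensor_def)
qed

lemma sharp_in_dual: "sharp X \<in> dual S"
  by (simp add: sharp_def dual_def inner_add_right)

lemma dual_nths: "set \<alpha>s \<subseteq> dual S \<Longrightarrow> set (nths \<alpha>s I) \<subseteq> dual S"
  using set_nths_subset[of \<alpha>s I] by blast

lemma length_nths_minus_one: "length Xs = Suc k \<Longrightarrow> i \<le> k \<Longrightarrow> length (nths Xs (- {i})) = k"
  using nths_minus_one_in_tuples[of Xs UNIV k i] by (simp add: tuples_def)

lemma length_nths_minus_two:
  "length Xs = Suc k \<Longrightarrow> i < j \<Longrightarrow> j \<le> k \<Longrightarrow> Suc (length (nths Xs (- {i, j}))) = k"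
  using nths_minus_two_in_tuples[of Xs UNIV "k - 1" i j] by (cases k) (simp_all add: tuples_def)

text \<open>Expanding the determinant by permutations, each product contains the entry \<open>Xs ! m\<close> in exactly one
  factor, which gives multilinearity; equal entries give equal columns.\<close>

lemma wedge_tensor_in_cochains:
  assumes \<alpha>s: "set \<alpha>s \<subseteq> dual S" "length \<alpha>s = k" and S: "subspace S"
  shows "wedge_tensor S \<alpha>s V \<in> cochains S k"
proof -
  let ?M = "\<lambda>Xs. Matrix.mat k k (\<lambda>(i, j). (\<alpha>s ! i) (Xs ! j))"
  let ?P = "{p. p permutes {..<k}}"
  define c where "c p m Xs = (\<Prod>j\<in>{..<k} - {m}. (\<alpha>s ! p j) (Xs ! j))" for p m Xs
  have det_update: "Determinant.det (?M (Xs[m := X])) =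
      (\<Sum>p\<in>?P. of_int (sign p) * ((\<alpha>s ! p m) X * c p m Xs))"
    if "length Xs = k" "m < k" for Xs m X
  proof -
    have "Determinant.det (?M (Xs[m := X])) =
        (\<Sum>p\<in>?P. of_int (sign p) * (\<Prod>j<k. ?M (Xs[m := X]) $$ (p j, j)))"
      using det_col[of "?M (Xs[m := X])" k] by (simp add: lessThan_atLeast0)
    also have "\<dots> = (\<Sum>p\<in>?P. of_int (sign p) * ((\<alpha>s ! p m) X * c p m Xs))"
    proof (intro sum.cong refl arg_cong2[where f = "(*)"])
      fix p assume "p \<in> ?P"
      then have p: "p j < k" if "j < k" for j using permutes_in_image[of p "{..<k}" j] that by auto
      have "(\<Prod>j<k. ?M (Xs[m := X]) $$ (p j, j)) = (\<Prod>j<k. (\<alpha>s ! p j) (Xs[m := X] ! j))"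
        by (rule prod.cong) (simp_all add: p)
      also have "\<dots> = (\<alpha>s ! p m) X * (\<Prod>j\<in>{..<k} - {m}. (\<alpha>s ! p j) (Xs[m := X] ! j))"
        using that by (subst prod.remove[of _ m]) auto
      also have "(\<Prod>j\<in>{..<k} - {m}. (\<alpha>s ! p j) (Xs[m := X] ! j)) = c p m Xs"
        unfolding c_def by (rule prod.cong) auto
      finally show "(\<Prod>j<k. ?M (Xs[m := X]) $$ (p j, j)) = (\<alpha>s ! p m) X * c p m Xs" .
    qed
    finally show ?thesis .
  qed
  have \<alpha>_dual: "\<alpha>s ! p m \<in> dual S" if "p \<in> ?P" "m < k" for p m
    using that \<alpha>s permutes_in_image[of p "{..<k}" m] by auto
  have \<alpha>_add: "(\<alpha>s ! p m) (X + Y) = (\<alpha>s ! p m) X + (\<alpha>s ! p m) Y"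
    and \<alpha>_scale: "(\<alpha>s ! p m) (a *\<^sub>R X) = a * (\<alpha>s ! p m) X"
    if "p \<in> ?P" "m < k" "X \<in> S" "Y \<in> S" for p m X Y a
    using \<alpha>_dual[OF that(1,2)] that by (auto simp: dual_def)
  show ?thesis
  proof (rule cochainI)
    fix Xs assume "Xs \<notin> tuples S k"
    then show "wedge_tensor S \<alpha>s V Xs = 0" by (simp add: wedge_tensor_def \<alpha>s)
  next
    fix Xs i X Y assume *: "Xs \<in> tuples S k" "i < k" "X \<in> S" "Y \<in> S"
    then have "Determinant.det (?M (Xs[i := X + Y])) =
        Determinant.det (?M (Xs[i := X])) + Determinant.det (?M (Xs[i := Y]))"
      by (simp add: det_update tuples_length \<alpha>_add sum.distrib[symmetric] algebra_simps)
    with * show "wedge_tensor S \<alpha>s V (Xs[i := X + Y]) =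
        wedge_tensor S \<alpha>s V (Xs[i := X]) + wedge_tensor S \<alpha>s V (Xs[i := Y])"
      using S by (simp add: wedge_tensor_def \<alpha>s tuples_update subspace_add scaleR_add_left)
  next
    fix Xs i X a assume *: "Xs \<in> tuples S k" "i < k" "X \<in> S"
    then have "Determinant.det (?M (Xs[i := a *\<^sub>R X])) = a * Determinant.det (?M (Xs[i := X]))"
      by (simp add: det_update tuples_length \<alpha>_scale sum_distrib_left algebra_simps)
    with * show "wedge_tensor S \<alpha>s V (Xs[i := a *\<^sub>R X]) = a *\<^sub>R wedge_tensor S \<alpha>s V (Xs[i := X])"
      using S by (simp add: wedge_tensor_def \<alpha>s tuples_update subspace_scale)
  next
    fix Xs i j assume *: "Xs \<in> tuples S k" "i < k" "j < k" "i \<noteq> j" "Xs ! i = Xs ! j"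
    have "Determinant.det (?M Xs) = 0"
    proof (rule det_identical_columns[of _ k i j])
      show "col (?M Xs) i = col (?M Xs) j"
        using * by (intro eq_vecI) auto
    qed (use * in auto)
    with * show "wedge_tensor S \<alpha>s V Xs = 0" by (simp add: wedge_tensor_def \<alpha>s)
  qed
qed

context parseval_frame
begin

lemma dual_sum:
  assumes "\<alpha> \<in> dual S" "finite J" "\<And>a. a \<in> J \<Longrightarrow> f a \<in> S"
  shows "\<alpha> (\<Sum>a\<in>J. c a *\<^sub>R f a) = (\<Sum>a\<in>J. c a * \<alpha> (f a))"
  using assms(2,3)
proof (induction J rule: finite_induct)
  case empty
  have "0 \<in> S" using frame_subspace by (rule subspace_0)
  then have "\<alpha> (0 *\<^sub>R 0) = 0 * \<alpha> 0" using assms(1) by (auto simp only: dual_def)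
  then show ?case by simp
next
  case (insert a J)
  then have "c a *\<^sub>R f a \<in> S" "(\<Sum>a\<in>J. c a *\<^sub>R f a) \<in> S"
    using frame_subspace by (auto intro!: subspace_sum subspace_scale)
  with insert assms(1) show ?case by (auto simp: dual_def)
qed

lemma eq_on_subspaceI:
  assumes "Y \<in> S" "Z \<in> S" "\<And>X. X \<in> S \<Longrightarrow> inner X Y = inner X Z"
  shows "Y = Z"
proof -
  have "Y - Z \<in> S" using assms frame_subspace by (simp add: subspace_diff)
  then have "inner (Y - Z) (Y - Z) = 0" using assms(3)[of "Y - Z"] by (simp add: inner_diff_right)
  then show ?thesis by simp
qed

lemma flat_unique:
  assumes "Z \<in> S" "\<And>X. X \<in> S \<Longrightarrow> inner Z X = \<alpha> X"
  shows "flat S \<alpha> = Z"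
  unfolding flat_def
  by (rule the_equality) (use assms in \<open>auto intro!: eq_on_subspaceI simp: inner_commute\<close>)

lemma flat_works:
  assumes "\<alpha> \<in> dual S"
  shows flat_in: "flat S \<alpha> \<in> S" and inner_flat: "X \<in> S \<Longrightarrow> inner (flat S \<alpha>) X = \<alpha> X"
proof -
  let ?Z = "\<Sum>e\<in>E. \<alpha> e *\<^sub>R e"
  have Z: "?Z \<in> S"
    using frame_subspace frame_subset by (intro subspace_sum subspace_scale) auto
  have inner_Z: "inner ?Z X = \<alpha> X" if "X \<in> S" for X
  proof -
    have "inner ?Z X = (\<Sum>e\<in>E. inner e X * \<alpha> e)" by (simp add: inner_sum_left mult.commute)
    also have "\<dots> = \<alpha> (\<Sum>e\<in>E. inner e X *\<^sub>R e)"
      using frame_finite frame_subset by (intro dual_sum[OF assms, symmetric]) auto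
    finally show ?thesis using that by (simp add: frame_expansion)
  qed
  have "flat S \<alpha> = ?Z" using Z inner_Z by (rule flat_unique)
  with Z inner_Z show "flat S \<alpha> \<in> S" "X \<in> S \<Longrightarrow> inner (flat S \<alpha>) X = \<alpha> X" by simp_all
qed

lemma flat_sharp: "Z \<in> S \<Longrightarrow> flat S (sharp Z) = Z"
  by (rule flat_unique) (simp_all add: sharp_def)

lemma map_flat_in_tuples: "set \<alpha>s \<subseteq> dual S \<Longrightarrow> length \<alpha>s = k \<Longrightarrow> map (flat S) \<alpha>s \<in> tuples S k"
  using flat_in by (auto simp: tuples_def)

text \<open>In an orthonormal basis the usual expansion runs over increasing tuples; the sum over all tuples counts
  each of its terms \<open>k!\<close> times.\<close>

lemma cochain_decomposition:
  assumes \<phi>: "\<phi> \<in> cochains S k"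
  shows "\<phi> = (\<lambda>Xs. \<Sum>Es\<in>tuples E k. (1 / fact k) *\<^sub>R wedge_tensor S (map sharp Es) (\<phi> Es) Xs)"
proof
  fix Xs
  show "\<phi> Xs = (\<Sum>Es\<in>tuples E k. (1 / fact k) *\<^sub>R wedge_tensor S (map sharp Es) (\<phi> Es) Xs)"
  proof (cases "Xs \<in> tuples S k")
    case True
    have "wedge_tensor S (map sharp Es) (\<phi> Es) Xs =
        Determinant.det (Matrix.mat k k (\<lambda>(i, j). inner (Xs ! i) (Es ! j))) *\<^sub>R \<phi> Es"
      if "Es \<in> tuples E k" for Es
    proof -
      let ?M = "Matrix.mat k k (\<lambda>(i, j). inner (Xs ! i) (Es ! j))"
      have "Matrix.mat k k (\<lambda>(i, j). (map sharp Es ! i) (Xs ! j)) = transpose_mat ?M"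
        using that by (auto intro!: eq_matI simp: sharp_def tuples_length inner_commute)
      then show ?thesis
        using that True det_transpose[of ?M k] by (simp add: wedge_tensor_def tuples_length)
    qed
    then have "(\<Sum>Es\<in>tuples E k. (1 / fact k) *\<^sub>R wedge_tensor S (map sharp Es) (\<phi> Es) Xs) =
        (1 / fact k) *\<^sub>R (\<Sum>Es\<in>tuples E k.
          Determinant.det (Matrix.mat k k (\<lambda>(i, j). inner (Xs ! i) (Es ! j))) *\<^sub>R \<phi> Es)"
      by (simp add: scaleR_sum_right)
    also have "\<dots> = \<phi> Xs" by (simp add: sum_frame_det[OF \<phi> True])
    finally show ?thesis by simp
  next
    case False
    then have "wedge_tensor S (map sharp Es) (\<phi> Es) Xs = 0" if "Es \<in> tuples E k" for Es
      using that by (simp add: wedge_tensor_def tuples_length)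
    with False show ?thesis by (simp add: cochain_outside[OF \<phi>])
  qed
qed

lemma cochain_induct [consumes 1, case_names wedge lincomb]:
  assumes \<phi>: "\<phi> \<in> cochains S k"
    and wedge: "\<And>\<alpha>s V. set \<alpha>s \<subseteq> dual S \<Longrightarrow> length \<alpha>s = k \<Longrightarrow> P (wedge_tensor S \<alpha>s V)"
    and lincomb: "\<And>\<phi> \<psi> a b. \<lbrakk>\<phi> \<in> cochains S k; \<psi> \<in> cochains S k; P \<phi>; P \<psi>\<rbrakk>
        \<Longrightarrow> P (\<lambda>Xs. a *\<^sub>R \<phi> Xs + b *\<^sub>R \<psi> Xs)"
  shows "P \<phi>"
proof -
  define t where "t Es = wedge_tensor S (map sharp Es) (\<phi> Es)" for Es
  have t: "t Es \<in> cochains S k" "P (t Es)" if "Es \<in> tuples E k" for Es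
    unfolding t_def using that sharp_in_dual frame_subspace
    by (auto intro!: wedge wedge_tensor_in_cochains simp: tuples_length)
  have "P (\<lambda>Xs. \<Sum>Es\<in>J. (1 / fact k) *\<^sub>R t Es Xs)" if "finite J" "J \<subseteq> tuples E k" for J
    using that
  proof (induction J rule: finite_induct)
    case empty
    \<comment> \<open>The zero cochain has to be produced as a linear combination of two cochains with \<open>P\<close>.\<close>
    let ?w = "wedge_tensor S (replicate k (sharp 0)) 0"
    have w: "set (replicate k (sharp 0)) \<subseteq> dual S" using sharp_in_dual by auto
    have "P (\<lambda>Xs. 0 *\<^sub>R ?w Xs + 0 *\<^sub>R ?w Xs)"
      using w frame_subspace by (intro lincomb wedge wedge_tensor_in_cochains) auto
    then show ?case by simp
  next
    case (insert Es J)
    then have sub: "J \<subseteq> tuples E k" and Es: "Es \<in> tuples E k" by auto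
    have J: "(\<lambda>Xs. \<Sum>Es\<in>J. (1 / fact k) *\<^sub>R t Es Xs) \<in> cochains S k"
      by (rule cochains_sum) (use t sub in \<open>auto intro!: cochains_scale\<close>)
    from lincomb[OF t(1)[OF Es] J t(2)[OF Es] insert.IH[OF sub], of "1 / fact k" 1]
    show ?case using insert.hyps by simp
  qed
  from this[OF finite_tuples order_refl] show ?thesis
    using cochain_decomposition[OF \<phi>] by (simp add: t_def)
qed

text \<open>The inner product of \<open>\<Lambda>\<^sup>k S\<^sup>* \<otimes> 'h\<close> as an explicit sum; it turns out to be independent of \<open>E\<close>.\<close>

definition frame_metric :: "nat \<Rightarrow> ('h list \<Rightarrow> 'h) \<Rightarrow> ('h list \<Rightarrow> 'h) \<Rightarrow> real" where
  "frame_metric k \<phi> \<psi> =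
     (if \<phi> \<in> cochains S k \<and> \<psi> \<in> cochains S k
      then (\<Sum>Es\<in>tuples E k. inner (\<phi> Es) (\<psi> Es)) / fact k else 0)"

text \<open>The entries \<open>\<gamma>\<^sub>i(e\<^sub>j)\<close> of the determinant in \<open>wedge_tensor\<close> are the products \<open>\<langle>\<gamma>\<^sub>i\<^sup>\<flat>, e\<^sub>j\<rangle>\<close>, so the sum over all tuples
  is the one of \<open>sum_frame_det\<close>.\<close>

lemma frame_metric_wedge:
  assumes \<phi>: "\<phi> \<in> cochains S k" and \<gamma>s: "set \<gamma>s \<subseteq> dual S" "length \<gamma>s = k"
  shows "frame_metric k \<phi> (wedge_tensor S \<gamma>s V) = inner (\<phi> (map (flat S) \<gamma>s)) V"
proof -
  let ?d = "\<lambda>Es. Determinant.det (Matrix.mat k k (\<lambda>(i, j). inner (map (flat S) \<gamma>s ! i) (Es ! j)))"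
  have "wedge_tensor S \<gamma>s V Es = ?d Es *\<^sub>R V" if "Es \<in> tuples E k" for Es
  proof -
    have "Es \<in> tuples S k" using that by (rule tuples_frame)
    then have "Matrix.mat k k (\<lambda>(i, j). (\<gamma>s ! i) (Es ! j)) =
        Matrix.mat k k (\<lambda>(i, j). inner (map (flat S) \<gamma>s ! i) (Es ! j))"
      using \<gamma>s by (intro cong_mat) (auto simp: inner_flat tuples_nth subset_iff)
    then show ?thesis using \<open>Es \<in> tuples S k\<close> \<gamma>s by (simp add: wedge_tensor_def)
  qed
  then have "(\<Sum>Es\<in>tuples E k. inner (\<phi> Es) (wedge_tensor S \<gamma>s V Es)) =
      inner (\<Sum>Es\<in>tuples E k. ?d Es *\<^sub>R \<phi> Es) V"
    by (simp add: inner_sum_left)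
  also have "\<dots> = fact k * inner (\<phi> (map (flat S) \<gamma>s)) V"
    by (subst sum_frame_det[OF \<phi> map_flat_in_tuples[OF \<gamma>s]]) simp
  finally show ?thesis
    using \<phi> wedge_tensor_in_cochains[OF \<gamma>s frame_subspace] by (simp add: frame_metric_def)
qed

lemma frame_metric_commute: "frame_metric k \<phi> \<psi> = frame_metric k \<psi> \<phi>"
  by (simp add: frame_metric_def inner_commute)

lemma frame_metric_lincomb:
  assumes "\<phi> \<in> cochains S k" "\<psi> \<in> cochains S k" "\<omega> \<in> cochains S k"
  shows "frame_metric k \<omega> (\<lambda>Xs. a *\<^sub>R \<phi> Xs + b *\<^sub>R \<psi> Xs) =
    a * frame_metric k \<omega> \<phi> + b * frame_metric k \<omega> \<psi>"
  using assms cochains_lincomb[OF assms(1,2), of a b]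
  by (simp add: frame_metric_def inner_add_right sum.distrib sum_distrib_left add_divide_distrib)

lemma is_induced_metric_frame_metric: "is_induced_metric S k (frame_metric k)"
  unfolding is_induced_metric_def
proof (intro conjI allI ballI impI)
  fix \<phi> \<psi> \<omega> :: "'h list \<Rightarrow> 'h" and a b
  assume *: "\<phi> \<in> cochains S k" "\<psi> \<in> cochains S k" "\<omega> \<in> cochains S k"
  show "frame_metric k \<omega> (\<lambda>Xs. a *\<^sub>R \<phi> Xs + b *\<^sub>R \<psi> Xs) =
    a * frame_metric k \<omega> \<phi> + b * frame_metric k \<omega> \<psi>"
    using * by (rule frame_metric_lincomb)
  then show "frame_metric k (\<lambda>Xs. a *\<^sub>R \<phi> Xs + b *\<^sub>R \<psi> Xs) \<omega> =
    a * frame_metric k \<phi> \<omega> + b * frame_metric k \<psi> \<omega>"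
    by (simp only: frame_metric_commute[of k _ \<omega>])
next
  fix \<beta>s \<gamma>s :: "('h \<Rightarrow> real) list" and V W :: 'h
  assume *: "set \<beta>s \<subseteq> dual S \<and> set \<gamma>s \<subseteq> dual S \<and> length \<beta>s = k \<and> length \<gamma>s = k"
  then have \<beta>s: "set \<beta>s \<subseteq> dual S" "length \<beta>s = k" and \<gamma>s: "set \<gamma>s \<subseteq> dual S" "length \<gamma>s = k" by auto
  have "frame_metric k (wedge_tensor S \<beta>s V) (wedge_tensor S \<gamma>s W) =
      inner (wedge_tensor S \<beta>s V (map (flat S) \<gamma>s)) W"
    by (rule frame_metric_wedge[OF wedge_tensor_in_cochains[OF \<beta>s frame_subspace] \<gamma>s])
  also have "Matrix.mat k k (\<lambda>(i, j). (\<beta>s ! i) (map (flat S) \<gamma>s ! j)) =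
      Matrix.mat k k (\<lambda>(i, j). inner (flat S (\<beta>s ! i)) (flat S (\<gamma>s ! j)))"
    using \<beta>s \<gamma>s by (intro cong_mat) (auto simp: inner_flat flat_in subset_iff)
  then have "wedge_tensor S \<beta>s V (map (flat S) \<gamma>s) =
      Determinant.det (Matrix.mat k k (\<lambda>(i, j). inner (flat S (\<beta>s ! i)) (flat S (\<gamma>s ! j)))) *\<^sub>R V"
    using map_flat_in_tuples[OF \<gamma>s] \<beta>s by (simp add: wedge_tensor_def)
  finally show "frame_metric k (wedge_tensor S \<beta>s V) (wedge_tensor S \<gamma>s W) =
      Determinant.det (Matrix.mat k k (\<lambda>(i, j). inner (flat S (\<beta>s ! i)) (flat S (\<gamma>s ! j)))) * inner V W"
    by simp
qed (auto simp: frame_metric_def)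

text \<open>Both forms are linear in each argument and decomposable cochains span, one argument at a time.\<close>

lemma induced_metric_unique:
  assumes B: "is_induced_metric S k B" and C: "is_induced_metric S k C"
  shows "B = C"
proof (intro ext)
  fix \<phi> \<psi>
  note lin = B[unfolded is_induced_metric_def, THEN conjunct2, THEN conjunct1, rule_format]
    C[unfolded is_induced_metric_def, THEN conjunct2, THEN conjunct1, rule_format]
  show "B \<phi> \<psi> = C \<phi> \<psi>"
  proof (cases "\<phi> \<in> cochains S k \<and> \<psi> \<in> cochains S k")
    case True
    have B_eq_C: "B \<phi> (wedge_tensor S \<gamma>s W) = C \<phi> (wedge_tensor S \<gamma>s W)"
      if \<phi>: "\<phi> \<in> cochains S k" and \<gamma>s: "set \<gamma>s \<subseteq> dual S" "length \<gamma>s = k" for \<phi> \<gamma>s W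
      using \<phi>
    proof (induction rule: cochain_induct)
      case (wedge \<beta>s V)
      with \<gamma>s B C show ?case unfolding is_induced_metric_def by simp
    next
      case (lincomb \<phi> \<psi> a b)
      with lin wedge_tensor_in_cochains[OF \<gamma>s frame_subspace] show ?case by simp
    qed
    from True have "\<psi> \<in> cochains S k" by simp
    then show ?thesis
    proof (induction rule: cochain_induct)
      case (wedge \<gamma>s W)
      with True show ?case by (simp add: B_eq_C)
    next
      case (lincomb \<phi>' \<psi>' a b)
      with lin True show ?case by simp
    qed
  next
    case False
    with B C show ?thesis unfolding is_induced_metric_def by metis
  qed
qed

lemma cochain_inner_eq: "cochain_inner S k = frame_metric k"
  unfolding cochain_inner_def
  using is_induced_metric_frame_metric induced_metric_unique by blast

lemma cochain_inner_wedge: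
  assumes "\<phi> \<in> cochains S k" "set \<gamma>s \<subseteq> dual S" "length \<gamma>s = k"
  shows "cochain_inner S k \<phi> (wedge_tensor S \<gamma>s V) = inner (\<phi> (map (flat S) \<gamma>s)) V"
  unfolding cochain_inner_eq using assms by (rule frame_metric_wedge)

lemma cochain_inner_commute: "cochain_inner S k \<phi> \<psi> = cochain_inner S k \<psi> \<phi>"
  unfolding cochain_inner_eq by (rule frame_metric_commute)

lemma cochain_inner_lincomb:
  assumes "\<phi> \<in> cochains S k" "\<psi> \<in> cochains S k" "\<omega> \<in> cochains S k"
  shows "cochain_inner S k \<omega> (\<lambda>Xs. a *\<^sub>R \<phi> Xs + b *\<^sub>R \<psi> Xs) =
    a * cochain_inner S k \<omega> \<phi> + b * cochain_inner S k \<omega> \<psi>"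
  unfolding cochain_inner_eq using assms by (rule frame_metric_lincomb)

lemma cochain_inner_add:
  assumes "\<phi> \<in> cochains S k" "\<psi> \<in> cochains S k" "\<omega> \<in> cochains S k"
  shows "cochain_inner S k \<omega> (\<lambda>Xs. \<phi> Xs + \<psi> Xs) = cochain_inner S k \<omega> \<phi> + cochain_inner S k \<omega> \<psi>"
  using cochain_inner_lincomb[OF assms, of 1 1] by simp

lemma cochain_inner_sum:
  assumes \<omega>: "\<omega> \<in> cochains S k" and \<phi>: "\<And>i. i \<in> J \<Longrightarrow> \<phi> i \<in> cochains S k"
  shows "cochain_inner S k \<omega> (\<lambda>Xs. \<Sum>i\<in>J. c i *\<^sub>R \<phi> i Xs) = (\<Sum>i\<in>J. c i * cochain_inner S k \<omega> (\<phi> i))"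
proof -
  have "(\<lambda>Xs. \<Sum>i\<in>J. c i *\<^sub>R \<phi> i Xs) \<in> cochains S k"
    using \<phi> by (intro cochains_sum cochains_scale)
  moreover have "(\<Sum>Es\<in>tuples E k. \<Sum>i\<in>J. c i * inner (\<omega> Es) (\<phi> i Es)) =
      (\<Sum>i\<in>J. \<Sum>Es\<in>tuples E k. c i * inner (\<omega> Es) (\<phi> i Es))"
    by (rule sum.swap)
  ultimately show ?thesis
    using \<omega> \<phi> by (simp add: cochain_inner_eq frame_metric_def inner_sum_right sum_divide_distrib[of _ J]
        sum_distrib_left[symmetric])
qed

text \<open>Nondegeneracy: pairing with \<open>(X\<^sub>1\<^sup>\<sharp> \<and> \<dots> \<and> X\<^sub>k\<^sup>\<sharp>) \<otimes> V\<close> recovers \<open>\<langle>\<phi>(X\<^sub>1, \<dots>, X\<^sub>k), V\<rangle>\<close>.\<close>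

lemma cochain_eqI_inner:
  assumes \<phi>: "\<phi> \<in> cochains S k" and \<psi>: "\<psi> \<in> cochains S k"
    and eq: "\<And>\<omega>. \<omega> \<in> cochains S k \<Longrightarrow> cochain_inner S k \<omega> \<phi> = cochain_inner S k \<omega> \<psi>"
  shows "\<phi> = \<psi>"
proof
  fix Xs
  show "\<phi> Xs = \<psi> Xs"
  proof (cases "Xs \<in> tuples S k")
    case True
    have dual: "set (map sharp Xs) \<subseteq> dual S" "length (map sharp Xs) = k"
      using True sharp_in_dual by (auto simp: tuples_length)
    have "map (flat S) (map sharp Xs) = Xs"
      using True by (auto intro!: map_idI simp: tuples_def flat_sharp subset_iff)
    then have "inner (\<phi> Xs) V = inner (\<psi> Xs) V" for V
      using eq[OF wedge_tensor_in_cochains[OF dual frame_subspace, of V]]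
        cochain_inner_wedge[OF \<phi> dual, of V] cochain_inner_wedge[OF \<psi> dual, of V]
      by (simp add: cochain_inner_commute[of k "wedge_tensor S (map sharp Xs) V"])
    then show ?thesis by (metis inner_eq_zero_iff inner_diff_left right_minus_eq)
  next
    case False
    then show ?thesis by (simp add: cochain_outside[OF \<phi>] cochain_outside[OF \<psi>])
  qed
qed

lemma adjoint_on_works:
  assumes f: "endomorphism_on S f"
  shows adjoint_on_in: "adjoint_on S f Y \<in> S"
    and inner_adjoint_on: "X \<in> S \<Longrightarrow> inner X (adjoint_on S f Y) = inner (f X) Y"
proof -
  let ?\<alpha> = "\<lambda>X. inner (f X) Y"
  have \<alpha>: "?\<alpha> \<in> dual S" using f by (auto simp: dual_def endomorphism_on_def inner_add_left)
  have "adjoint_on S f Y = flat S ?\<alpha>"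
    unfolding adjoint_on_def
  proof (rule the_equality)
    show "flat S ?\<alpha> \<in> S \<and> (\<forall>X\<in>S. inner (f X) Y = inner X (flat S ?\<alpha>))"
      using flat_in[OF \<alpha>] inner_flat[OF \<alpha>] by (simp add: inner_commute)
  next
    fix Z assume "Z \<in> S \<and> (\<forall>X\<in>S. inner (f X) Y = inner X Z)"
    then show "Z = flat S ?\<alpha>"
      by (intro flat_unique[symmetric]) (simp_all add: inner_commute)
  qed
  then show "adjoint_on S f Y \<in> S" "X \<in> S \<Longrightarrow> inner X (adjoint_on S f Y) = inner (f X) Y"
    using flat_in[OF \<alpha>] inner_flat[OF \<alpha>, of X] by (simp_all add: inner_commute)
qed

lemma adjoint_on_inverse:
  assumes f: "endomorphism_on S f" and g: "endomorphism_on S g"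
    and inv: "\<And>X. X \<in> S \<Longrightarrow> g (f X) = X" and Z: "Z \<in> S"
  shows "adjoint_on S f (adjoint_on S g Z) = Z"
proof (rule eq_on_subspaceI[OF adjoint_on_in[OF f] Z])
  fix X assume X: "X \<in> S"
  then have "f X \<in> S" using f by (simp add: endomorphism_on_def)
  with X inv show "inner X (adjoint_on S f (adjoint_on S g Z)) = inner X Z"
    by (simp add: inner_adjoint_on[OF f] inner_adjoint_on[OF g])
qed

end

section \<open>The codifferential on decomposable cochains\<close>

lemma sharp_apply: "sharp X Y = inner X Y"
  by (simp add: sharp_def)

definition codifferential_formula ::
  "('h::euclidean_space \<Rightarrow> 'h \<Rightarrow> 'h) \<Rightarrow> 'h set \<Rightarrow> nat \<Rightarrow> ('h \<Rightarrow> real) list \<Rightarrow> 'h \<Rightarrow> 'h list \<Rightarrow> 'h" where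
  "codifferential_formula br S k \<alpha>s V = (\<lambda>Xs.
     (\<Sum>i\<le>k. (- 1) ^ i *\<^sub>R
        wedge_tensor S (nths \<alpha>s (- {i})) (adjoint (br (flat S (\<alpha>s ! i))) V) Xs) +
     (\<Sum>j\<le>k. \<Sum>i<j. (- 1) ^ (i + j) *\<^sub>R
        wedge_tensor S (sharp (br (flat S (\<alpha>s ! i)) (flat S (\<alpha>s ! j))) # nths \<alpha>s (- {i, j})) V Xs))"

text \<open>The action of a group element \<open>g\<close> on cochains, with \<open>a\<close> in the role of \<open>Ad\<^sub>g\<close> and \<open>b\<close> in the role of
  \<open>Ad\<^sup>-\<close> at the inverse of \<open>g\<close>.\<close>

definition twisted_action ::
  "'h::real_vector set \<Rightarrow> ('h \<Rightarrow> 'h) \<Rightarrow> ('h \<Rightarrow> 'h) \<Rightarrow> nat \<Rightarrow> ('h list \<Rightarrow> 'h) \<Rightarrow> 'h list \<Rightarrow> 'h" where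
  "twisted_action S a b k \<phi> Xs = (if Xs \<in> tuples S k then a (\<phi> (map b Xs)) else 0)"

locale metric_lie_subalgebra = parseval_frame S E + lie_algebra_with_subalgebra br S
  for S E :: "'h::euclidean_space set" and br :: "'h \<Rightarrow> 'h \<Rightarrow> 'h"
begin

lemma codifferential_formula_terms:
  assumes \<alpha>s: "set \<alpha>s \<subseteq> dual S" "length \<alpha>s = Suc k"
  shows codifferential_formula_term1: "i \<le> k \<Longrightarrow>
      set (nths \<alpha>s (- {i})) \<subseteq> dual S \<and> length (nths \<alpha>s (- {i})) = k"
    and codifferential_formula_term2: "i < j \<Longrightarrow> j \<le> k \<Longrightarrow>
      set (sharp Z # nths \<alpha>s (- {i, j})) \<subseteq> dual S \<and> length (sharp Z # nths \<alpha>s (- {i, j})) = k"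
  using dual_nths[OF \<alpha>s(1)] length_nths_minus_one[OF \<alpha>s(2)] length_nths_minus_two[OF \<alpha>s(2)]
  by (auto simp: sharp_in_dual)

lemma codifferential_formula_in_cochains:
  assumes \<alpha>s: "set \<alpha>s \<subseteq> dual S" "length \<alpha>s = Suc k"
  shows "codifferential_formula br S k \<alpha>s V \<in> cochains S k"
  unfolding codifferential_formula_def
  by (rule cochains_add; intro cochains_sum cochains_scale wedge_tensor_in_cochains subspace)
    (use codifferential_formula_terms[OF \<alpha>s] in auto)

text \<open>The left-hand side is \<open>\<langle>\<partial>\<omega>(\<alpha>\<^sub>0\<^sup>\<flat>, \<dots>, \<alpha>\<^sub>k\<^sup>\<flat>), V\<rangle>\<close>.  In the first sum \<open>\<langle>[Z\<^sub>i, \<omega>(\<dots>)], V\<rangle> = \<langle>\<omega>(\<dots>), (ad Z\<^sub>i)\<^sup>* V\<rangle>\<close>, and every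
  \<open>\<langle>\<omega>(\<dots>), W\<rangle>\<close> is again the pairing of \<open>\<omega>\<close> with a decomposable cochain.\<close>

lemma differential_adjoint_wedge:
  assumes \<omega>: "\<omega> \<in> cochains S k" and \<alpha>s: "set \<alpha>s \<subseteq> dual S" "length \<alpha>s = Suc k"
  shows "cochain_inner S (Suc k) (differential br S k \<omega>) (wedge_tensor S \<alpha>s V) =
    cochain_inner S k \<omega> (codifferential_formula br S k \<alpha>s V)"
proof -
  define Z where "Z i = flat S (\<alpha>s ! i)" for i
  let ?Zs = "map (flat S) \<alpha>s"
  have Z: "Z i \<in> S" if "i \<le> k" for i
    using \<alpha>s that by (auto simp: Z_def intro!: flat_in)
  note term1 = codifferential_formula_term1[OF \<alpha>s] and term2 = codifferential_formula_term2[OF \<alpha>s]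
  define w1 where "w1 i = wedge_tensor S (nths \<alpha>s (- {i})) (adjoint (br (Z i)) V)" for i
  define w2 where "w2 i j = wedge_tensor S (sharp (br (Z i) (Z j)) # nths \<alpha>s (- {i, j})) V" for i j
  have w1_in: "w1 i \<in> cochains S k" if "i \<le> k" for i
    unfolding w1_def by (rule wedge_tensor_in_cochains) (use term1[OF that] subspace in auto)
  have w2_in: "w2 i j \<in> cochains S k" if "i < j" "j \<le> k" for i j
    unfolding w2_def by (rule wedge_tensor_in_cochains) (use term2[OF that] subspace in auto)
  have w1: "cochain_inner S k \<omega> (w1 i) = inner (br (Z i) (\<omega> (nths ?Zs (- {i})))) V" if "i \<le> k" for i
    unfolding w1_def using term1[OF that] adjoint_works[OF linear_br_right[of "Z i"]]
    by (simp add: cochain_inner_wedge[OF \<omega>] nths_map)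
  have w2: "cochain_inner S k \<omega> (w2 i j) = inner (\<omega> (br (Z i) (Z j) # nths ?Zs (- {i, j}))) V"
    if "i < j" "j \<le> k" for i j
  proof -
    have "flat S (sharp (br (Z i) (Z j))) = br (Z i) (Z j)"
      using that Z by (intro flat_sharp closed) auto
    then show ?thesis
      unfolding w2_def using term2[OF that, of "br (Z i) (Z j)"]
      by (subst cochain_inner_wedge[OF \<omega>]) (auto simp: nths_map)
  qed
  have "cochain_inner S (Suc k) (differential br S k \<omega>) (wedge_tensor S \<alpha>s V) =
      inner (differential br S k \<omega> ?Zs) V"
    by (rule cochain_inner_wedge[OF differential_in_cochains[OF \<omega>] \<alpha>s])
  also have "\<dots> = (\<Sum>i\<le>k. (- 1) ^ i * inner (br (Z i) (\<omega> (nths ?Zs (- {i})))) V) +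
      (\<Sum>j\<le>k. \<Sum>i<j. (- 1) ^ (i + j) * inner (\<omega> (br (Z i) (Z j) # nths ?Zs (- {i, j}))) V)"
    using map_flat_in_tuples[OF \<alpha>s] \<alpha>s(2)
    by (simp add: differential_def inner_add_left inner_sum_left Z_def)
  also have "\<dots> = (\<Sum>i\<le>k. (- 1) ^ i * cochain_inner S k \<omega> (w1 i)) +
      (\<Sum>j\<le>k. \<Sum>i<j. (- 1) ^ (i + j) * cochain_inner S k \<omega> (w2 i j))"
    by (simp add: w1 w2)
  \<comment> \<open>The factor 1 gives the outer sum the shape of a linear combination, as in \<open>cochain_inner_sum\<close>.\<close>
  also have "\<dots> = cochain_inner S k \<omega> (\<lambda>Xs. \<Sum>i\<le>k. (- 1) ^ i *\<^sub>R w1 i Xs) +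
      cochain_inner S k \<omega> (\<lambda>Xs. \<Sum>j\<le>k. 1 *\<^sub>R (\<Sum>i<j. (- 1) ^ (i + j) *\<^sub>R w2 i j Xs))"
  proof -
    have "cochain_inner S k \<omega> (\<lambda>Xs. \<Sum>j\<le>k. 1 *\<^sub>R (\<Sum>i<j. (- 1) ^ (i + j) *\<^sub>R w2 i j Xs)) =
        (\<Sum>j\<le>k. 1 * cochain_inner S k \<omega> (\<lambda>Xs. \<Sum>i<j. (- 1) ^ (i + j) *\<^sub>R w2 i j Xs))"
      by (rule cochain_inner_sum[OF \<omega>]) (auto intro!: cochains_sum cochains_scale w2_in)
    also have "\<dots> = (\<Sum>j\<le>k. \<Sum>i<j. (- 1) ^ (i + j) * cochain_inner S k \<omega> (w2 i j))"
      unfolding mult_1 by (intro sum.cong refl cochain_inner_sum[OF \<omega>]) (auto intro: w2_in)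
    finally have "cochain_inner S k \<omega> (\<lambda>Xs. \<Sum>j\<le>k. 1 *\<^sub>R (\<Sum>i<j. (- 1) ^ (i + j) *\<^sub>R w2 i j Xs)) =
        (\<Sum>j\<le>k. \<Sum>i<j. (- 1) ^ (i + j) * cochain_inner S k \<omega> (w2 i j))" .
    moreover have "cochain_inner S k \<omega> (\<lambda>Xs. \<Sum>i\<le>k. (- 1) ^ i *\<^sub>R w1 i Xs) =
        (\<Sum>i\<le>k. (- 1) ^ i * cochain_inner S k \<omega> (w1 i))"
      by (rule cochain_inner_sum[OF \<omega>]) (auto intro: w1_in)
    ultimately show ?thesis by (simp only:)
  qed
  also have "\<dots> = cochain_inner S k \<omega> (\<lambda>Xs. (\<Sum>i\<le>k. (- 1) ^ i *\<^sub>R w1 i Xs) +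
      (\<Sum>j\<le>k. 1 *\<^sub>R (\<Sum>i<j. (- 1) ^ (i + j) *\<^sub>R w2 i j Xs)))"
    using w1_in w2_in
    by (intro cochain_inner_add[OF _ _ \<omega>, symmetric] cochains_sum cochains_scale) auto
  finally show ?thesis
    by (simp add: codifferential_formula_def w1_def w2_def Z_def)
qed

lemma codifferential_eqI:
  assumes \<psi>: "\<psi> \<in> cochains S k"
    and adj: "\<And>\<omega>. \<omega> \<in> cochains S k \<Longrightarrow>
      cochain_inner S (Suc k) (differential br S k \<omega>) \<phi> = cochain_inner S k \<omega> \<psi>"
  shows "codifferential br S k \<phi> = \<psi>"
  unfolding codifferential_def
  by (rule the_equality) (use \<psi> adj in \<open>auto intro!: cochain_eqI_inner\<close>)

theorem codifferential_wedge:
  assumes "set \<alpha>s \<subseteq> dual S" "length \<alpha>s = Suc k"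
  shows "codifferential br S k (wedge_tensor S \<alpha>s V) = codifferential_formula br S k \<alpha>s V"
  using assms by (intro codifferential_eqI codifferential_formula_in_cochains differential_adjoint_wedge)

text \<open>The metric adjoint exists on decomposable cochains by the explicit formula, hence on their span.\<close>

lemma codifferential_works:
  assumes "\<phi> \<in> cochains S (Suc k)"
  shows "codifferential br S k \<phi> \<in> cochains S k \<and> (\<forall>\<omega>\<in>cochains S k.
    cochain_inner S (Suc k) (differential br S k \<omega>) \<phi> = cochain_inner S k \<omega> (codifferential br S k \<phi>))"
proof -
  have "\<exists>\<psi>\<in>cochains S k. \<forall>\<omega>\<in>cochains S k.
      cochain_inner S (Suc k) (differential br S k \<omega>) \<phi> = cochain_inner S k \<omega> \<psi>"
    using assms
  proof (induction rule: cochain_induct)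
    case (wedge \<alpha>s V)
    then show ?case
      by (intro bexI[of _ "codifferential_formula br S k \<alpha>s V"] ballI
          differential_adjoint_wedge codifferential_formula_in_cochains)
  next
    case (lincomb \<phi> \<psi> a b)
    then obtain \<phi>' \<psi>' where *: "\<phi>' \<in> cochains S k" "\<psi>' \<in> cochains S k"
      "\<forall>\<omega>\<in>cochains S k. cochain_inner S (Suc k) (differential br S k \<omega>) \<phi> = cochain_inner S k \<omega> \<phi>'"
      "\<forall>\<omega>\<in>cochains S k. cochain_inner S (Suc k) (differential br S k \<omega>) \<psi> = cochain_inner S k \<omega> \<psi>'"
      by blast
    then show ?case
      using lincomb.hyps
      by (intro bexI[of _ "\<lambda>Xs. a *\<^sub>R \<phi>' Xs + b *\<^sub>R \<psi>' Xs"])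
        (auto simp: cochain_inner_lincomb differential_in_cochains intro!: cochains_lincomb)
  qed
  then obtain \<psi> where \<psi>: "\<psi> \<in> cochains S k" "\<forall>\<omega>\<in>cochains S k.
      cochain_inner S (Suc k) (differential br S k \<omega>) \<phi> = cochain_inner S k \<omega> \<psi>" by blast
  then have "codifferential br S k \<phi> = \<psi>" by (intro codifferential_eqI) auto
  with \<psi> show ?thesis by simp
qed

lemma codifferential_lincomb:
  assumes "\<phi> \<in> cochains S (Suc k)" "\<psi> \<in> cochains S (Suc k)"
  shows "codifferential br S k (\<lambda>Xs. a *\<^sub>R \<phi> Xs + b *\<^sub>R \<psi> Xs) =
    (\<lambda>Xs. a *\<^sub>R codifferential br S k \<phi> Xs + b *\<^sub>R codifferential br S k \<psi> Xs)"
  using codifferential_works[OF assms(1)] codifferential_works[OF assms(2)] assms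
  by (intro codifferential_eqI)
    (auto simp: cochain_inner_lincomb differential_in_cochains intro!: cochains_lincomb)

end

section \<open>Invariance of the codifferential\<close>

text \<open>A single group element \<open>g\<close>: \<open>a\<close> stands for \<open>Ad\<^sub>g\<close>, and \<open>b\<close> and \<open>b'\<close> stand for \<open>Ad\<^sup>-\<close> at \<open>g\<close> and at its
  inverse.\<close>

locale twisted_metric_lie_subalgebra = metric_lie_subalgebra S E br
  for S E :: "'h::euclidean_space set" and br :: "'h \<Rightarrow> 'h \<Rightarrow> 'h" +
  fixes a b b' :: "'h \<Rightarrow> 'h"
  assumes linear_a: "linear a" and inj_a: "inj a"
    and endo_b: "endomorphism_on S b" and endo_b': "endomorphism_on S b'"
    and b_b': "X \<in> S \<Longrightarrow> b (b' X) = X" and b'_b: "X \<in> S \<Longrightarrow> b' (b X) = X"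
begin

abbreviation b_adj where "b_adj \<equiv> adjoint_on S b"
abbreviation b'_adj where "b'_adj \<equiv> adjoint_on S b'"
abbreviation act where "act \<equiv> twisted_action S a b'"

lemma b_adj_b'_adj: "Z \<in> S \<Longrightarrow> b_adj (b'_adj Z) = Z"
  by (rule adjoint_on_inverse[OF endo_b endo_b' b'_b])

lemma b'_adj_b_adj: "Z \<in> S \<Longrightarrow> b'_adj (b_adj Z) = Z"
  by (rule adjoint_on_inverse[OF endo_b' endo_b b_b'])

lemma b'_in: "X \<in> S \<Longrightarrow> b' X \<in> S"
  using endo_b' by (simp add: endomorphism_on_def)

lemma comp_b'_in_dual: "\<alpha> \<in> dual S \<Longrightarrow> \<alpha> \<circ> b' \<in> dual S"
  using endo_b' by (auto simp: dual_def endomorphism_on_def)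

lemma flat_comp_b': "\<alpha> \<in> dual S \<Longrightarrow> flat S (\<alpha> \<circ> b') = b'_adj (flat S \<alpha>)"
proof (rule flat_unique)
  show "b'_adj (flat S \<alpha>) \<in> S" by (rule adjoint_on_in[OF endo_b'])
  fix X assume "\<alpha> \<in> dual S" "X \<in> S"
  then show "inner (b'_adj (flat S \<alpha>)) X = (\<alpha> \<circ> b') X"
    using inner_adjoint_on[OF endo_b', of X "flat S \<alpha>"] inner_flat[of \<alpha> "b' X"] b'_in[of X]
    by (simp add: inner_commute)
qed

lemma act_wedge: "length \<alpha>s = k \<Longrightarrow>
    act k (wedge_tensor S \<alpha>s V) = wedge_tensor S (map (\<lambda>\<alpha>. \<alpha> \<circ> b') \<alpha>s) (a V)"
proof
  fix Xs assume len: "length \<alpha>s = k"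
  show "act k (wedge_tensor S \<alpha>s V) Xs = wedge_tensor S (map (\<lambda>\<alpha>. \<alpha> \<circ> b') \<alpha>s) (a V) Xs"
  proof (cases "Xs \<in> tuples S k")
    case True
    then have "map b' Xs \<in> tuples S k" using b'_in by (auto simp: tuples_def)
    moreover have "Matrix.mat k k (\<lambda>(i, j). (\<alpha>s ! i) (map b' Xs ! j)) =
        Matrix.mat k k (\<lambda>(i, j). (map (\<lambda>\<alpha>. \<alpha> \<circ> b') \<alpha>s ! i) (Xs ! j))"
      using True len by (intro cong_mat) (auto simp: tuples_length)
    ultimately show ?thesis
      using True len by (simp add: twisted_action_def wedge_tensor_def linear_scale[OF linear_a])
  next
    case False
    with len show ?thesis by (simp add: twisted_action_def wedge_tensor_def)
  qed
qed

lemma act_lincomb: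
  "act k (\<lambda>Xs. x *\<^sub>R \<phi> Xs + y *\<^sub>R \<psi> Xs) = (\<lambda>Xs. x *\<^sub>R act k \<phi> Xs + y *\<^sub>R act k \<psi> Xs)"
  by (rule ext) (simp add: twisted_action_def linear_add[OF linear_a] linear_scale[OF linear_a])

lemma act_in_cochains:
  assumes "\<phi> \<in> cochains S k" shows "act k \<phi> \<in> cochains S k"
  using assms
proof (induction rule: cochain_induct)
  case (wedge \<alpha>s V)
  then have "set (map (\<lambda>\<alpha>. \<alpha> \<circ> b') \<alpha>s) \<subseteq> dual S" "length (map (\<lambda>\<alpha>. \<alpha> \<circ> b') \<alpha>s) = k"
    using comp_b'_in_dual by auto
  then show ?case
    using wedge subspace by (simp add: act_wedge wedge_tensor_in_cochains)
next
  case (lincomb \<phi> \<psi> x y)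
  then show ?case by (simp add: act_lincomb cochains_lincomb)
qed

text \<open>The adjoint of the right-hand identity is \<open>ad\<^sub>Z \<circ> a\<^sup>* = a\<^sup>* \<circ> ad\<^sub>Y\<close> with \<open>Y = b'\<^sup>* Z\<close>; substitute \<open>b\<^sup>* Z\<close> for \<open>Z\<close>.\<close>

lemma adjoint_equivariance_iff:
  "(\<forall>Z\<in>S. \<forall>W. adjoint a (br Z W) = br (b_adj Z) (adjoint a W)) \<longleftrightarrow>
   (\<forall>Z\<in>S. \<forall>V. a (adjoint (br Z) V) = adjoint (br (b'_adj Z)) (a V))"
proof -
  have *: "inner (a (adjoint (br Z) V)) W = inner V (br Z (adjoint a W))"
    "inner (adjoint (br (b'_adj Z)) (a V)) W = inner V (adjoint a (br (b'_adj Z) W))" for Z V W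
    using adjoint_works[OF linear_a, of "adjoint (br Z) V" W]
      adjoint_works[OF linear_br_right[of Z], of "adjoint a W" V]
      adjoint_works[OF linear_br_right[of "b'_adj Z"], of W "a V"]
      adjoint_works[OF linear_a, of V "br (b'_adj Z) W"]
    by (simp_all add: inner_commute)
  have eq: "(\<forall>V. a (adjoint (br Z) V) = adjoint (br (b'_adj Z)) (a V)) \<longleftrightarrow>
      (\<forall>W. adjoint a (br (b'_adj Z) W) = br Z (adjoint a W))" for Z
  proof
    assume "\<forall>V. a (adjoint (br Z) V) = adjoint (br (b'_adj Z)) (a V)"
    then have "inner V (br Z (adjoint a W)) = inner V (adjoint a (br (b'_adj Z) W))" for V W
      using *[of Z V W] by simp
    then show "\<forall>W. adjoint a (br (b'_adj Z) W) = br Z (adjoint a W)"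
      by (metis vector_eq_ldot)
  next
    assume "\<forall>W. adjoint a (br (b'_adj Z) W) = br Z (adjoint a W)"
    then have "inner (a (adjoint (br Z) V)) W = inner (adjoint (br (b'_adj Z)) (a V)) W" for V W
      using *[of Z V W] by simp
    then show "\<forall>V. a (adjoint (br Z) V) = adjoint (br (b'_adj Z)) (a V)"
      by (metis vector_eq_rdot)
  qed
  show ?thesis
    unfolding Ball_def[of S] eq
    by (metis adjoint_on_in[OF endo_b] adjoint_on_in[OF endo_b'] b_adj_b'_adj b'_adj_b_adj)
qed

lemma bracket_equivariance_iff:
  "(\<forall>Z\<in>S. \<forall>W\<in>S. b_adj (br Z W) = br (b_adj Z) (b_adj W)) \<longleftrightarrow>
   (\<forall>Z\<in>S. \<forall>W\<in>S. b'_adj (br Z W) = br (b'_adj Z) (b'_adj W))"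
  by (metis adjoint_on_in[OF endo_b] adjoint_on_in[OF endo_b'] b_adj_b'_adj b'_adj_b_adj closed)

lemma act_codifferential_formula:
  assumes \<alpha>s: "set \<alpha>s \<subseteq> dual S" "length \<alpha>s = Suc k"
    and ad: "\<And>Z V. Z \<in> S \<Longrightarrow> a (adjoint (br Z) V) = adjoint (br (b'_adj Z)) (a V)"
    and bracket: "\<And>Z W. Z \<in> S \<Longrightarrow> W \<in> S \<Longrightarrow> b'_adj (br Z W) = br (b'_adj Z) (b'_adj W)"
  shows "act k (codifferential_formula br S k \<alpha>s V) =
    codifferential_formula br S k (map (\<lambda>\<alpha>. \<alpha> \<circ> b') \<alpha>s) (a V)"
proof
  fix Xs
  let ?\<beta>s = "map (\<lambda>\<alpha>. \<alpha> \<circ> b') \<alpha>s"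
  define Z where "Z i = flat S (\<alpha>s ! i)" for i
  have dual: "\<alpha>s ! i \<in> dual S" if "i \<le> k" for i using \<alpha>s that by auto
  have Z: "Z i \<in> S" if "i \<le> k" for i unfolding Z_def using dual[OF that] by (rule flat_in)
  have flat: "flat S (?\<beta>s ! i) = b'_adj (Z i)" if "i \<le> k" for i
    using \<alpha>s that flat_comp_b'[OF dual[OF that]] by (simp add: Z_def comp_def)
  note term1 = codifferential_formula_term1[OF \<alpha>s] and term2 = codifferential_formula_term2[OF \<alpha>s]
  have act1: "act k (wedge_tensor S (nths \<alpha>s (- {i})) (adjoint (br (Z i)) V)) =
      wedge_tensor S (nths ?\<beta>s (- {i})) (adjoint (br (flat S (?\<beta>s ! i))) (a V))" if "i \<le> k" for i
    using term1[OF that] that by (simp add: act_wedge ad Z flat nths_map)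
  have act2: "act k (wedge_tensor S (sharp (br (Z i) (Z j)) # nths \<alpha>s (- {i, j})) V) =
      wedge_tensor S (sharp (br (flat S (?\<beta>s ! i)) (flat S (?\<beta>s ! j))) # nths ?\<beta>s (- {i, j})) (a V)"
    if ij: "i < j" "j \<le> k" for i j
  proof -
    have sharp: "(sharp (br (Z i) (Z j)) \<circ> b') X = sharp (br (flat S (?\<beta>s ! i)) (flat S (?\<beta>s ! j))) X"
      if X: "X \<in> S" for X
    proof -
      have "br (flat S (?\<beta>s ! i)) (flat S (?\<beta>s ! j)) = b'_adj (br (Z i) (Z j))"
        using ij by (simp only: flat bracket Z order.strict_implies_order[OF order.strict_trans2[OF ij]])
      then show ?thesis
        using inner_adjoint_on[OF endo_b' X, of "br (Z i) (Z j)"]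
        by (simp add: sharp_def inner_commute)
    qed
    have "act k (wedge_tensor S (sharp (br (Z i) (Z j)) # nths \<alpha>s (- {i, j})) V) =
        wedge_tensor S ((sharp (br (Z i) (Z j)) \<circ> b') # nths ?\<beta>s (- {i, j})) (a V)"
      using term2[OF ij] by (subst act_wedge) (auto simp: nths_map)
    also have "\<dots> =
        wedge_tensor S (sharp (br (flat S (?\<beta>s ! i)) (flat S (?\<beta>s ! j))) # nths ?\<beta>s (- {i, j})) (a V)"
      by (rule wedge_tensor_cong) (auto simp: nth_Cons' sharp simp del: comp_apply)
    finally show ?thesis .
  qed
  show "act k (codifferential_formula br S k \<alpha>s V) Xs = codifferential_formula br S k ?\<beta>s (a V) Xs"
  proof (cases "Xs \<in> tuples S k")
    case True
    then have act_def: "act k \<phi> Xs = a (\<phi> (map b' Xs))" for \<phi>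
      by (simp add: twisted_action_def)
    have "act k (codifferential_formula br S k \<alpha>s V) Xs =
        (\<Sum>i\<le>k. (- 1) ^ i *\<^sub>R
          act k (wedge_tensor S (nths \<alpha>s (- {i})) (adjoint (br (Z i)) V)) Xs) +
        (\<Sum>j\<le>k. \<Sum>i<j. (- 1) ^ (i + j) *\<^sub>R
          act k (wedge_tensor S (sharp (br (Z i) (Z j)) # nths \<alpha>s (- {i, j})) V) Xs)"
      unfolding act_def codifferential_formula_def Z_def
      by (simp add: linear_add[OF linear_a] linear_sum[OF linear_a] linear_scale[OF linear_a])
    also have "\<dots> = codifferential_formula br S k ?\<beta>s (a V) Xs"
      unfolding codifferential_formula_def by (simp add: act1 act2 del: nth_map)
    finally show ?thesis .
  next
    case False
    have "set ?\<beta>s \<subseteq> dual S" "length ?\<beta>s = Suc k"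
      using \<alpha>s comp_b'_in_dual by auto
    from cochain_outside[OF codifferential_formula_in_cochains[OF this] False] False
    show ?thesis by (simp add: twisted_action_def)
  qed
qed

text \<open>Both conditions are used in the form that refers to \<open>b'\<^sup>*\<close>.  Invariance in degree \<open>k = 0\<close> on \<open>Z\<^sup>\<sharp> \<otimes> V\<close> is
  the condition on \<open>a\<close>.  In degree \<open>k = 1\<close> on \<open>(Z\<^sup>\<sharp> \<and> W\<^sup>\<sharp>) \<otimes> V\<close> the terms with \<open>ad\<^sup>*\<close> then cancel, which leaves an
  equation between multiples of \<open>a V\<close>.  Conversely the conditions match the explicit formulas term by
  term, and decomposable cochains span.\<close>

theorem codifferential_equivariant_iff:
  "(\<forall>k. \<forall>\<phi>\<in>cochains S (Suc k). codifferential br S k (act (Suc k) \<phi>) = act k (codifferential br S k \<phi>)) \<longleftrightarrow>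
    (\<forall>Z\<in>S. \<forall>W. adjoint a (br Z W) = br (b_adj Z) (adjoint a W)) \<and>
    (\<forall>Z\<in>S. \<forall>W\<in>S. b_adj (br Z W) = br (b_adj Z) (b_adj W))"
  (is "?equivariant \<longleftrightarrow> _")
  unfolding adjoint_equivariance_iff bracket_equivariance_iff
proof (intro iffI conjI ballI allI)
  assume equivariant: ?equivariant
  have formula_eq: "codifferential_formula br S k (map (\<lambda>\<alpha>. \<alpha> \<circ> b') \<alpha>s) (a V) Xs =
      act k (codifferential_formula br S k \<alpha>s V) Xs"
    if \<alpha>s: "set \<alpha>s \<subseteq> dual S" "length \<alpha>s = Suc k" for k \<alpha>s V Xs
  proof -
    have "set (map (\<lambda>\<alpha>. \<alpha> \<circ> b') \<alpha>s) \<subseteq> dual S" "length (map (\<lambda>\<alpha>. \<alpha> \<circ> b') \<alpha>s) = Suc k"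
      using \<alpha>s comp_b'_in_dual by auto
    from codifferential_wedge[OF this, of "a V"]
    show ?thesis
      using equivariant[rule_format, OF wedge_tensor_in_cochains[OF \<alpha>s subspace], of V]
      by (simp add: act_wedge[OF \<alpha>s(2)] codifferential_wedge[OF \<alpha>s])
  qed
  have flat_b': "flat S (sharp Z \<circ> b') = b'_adj Z" if "Z \<in> S" for Z
    using flat_comp_b'[OF sharp_in_dual, of Z] that by (simp add: flat_sharp)
  show ad: "a (adjoint (br Z) V) = adjoint (br (b'_adj Z)) (a V)" if Z: "Z \<in> S" for Z V
    using formula_eq[of "[sharp Z]" 0 V "[]"] Z sharp_in_dual[of Z S]
    by (simp add: codifferential_formula_def wedge_tensor_def twisted_action_def flat_b' flat_sharp)
  fix Z W assume Z: "Z \<in> S" and W: "W \<in> S"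
  \<comment> \<open>The equation in degree 1 only compares coefficients of \<open>a V\<close>, so this vector must not vanish.\<close>
  obtain V :: 'h where V: "V \<noteq> 0" by (metis nonempty_Basis nonzero_Basis ex_in_conv)
  then have aV: "a V \<noteq> 0" using inj_a linear_0[OF linear_a] by (metis injD)
  show "b'_adj (br Z W) = br (b'_adj Z) (b'_adj W)"
  proof (rule eq_on_subspaceI)
    show "b'_adj (br Z W) \<in> S" by (rule adjoint_on_in[OF endo_b'])
    show "br (b'_adj Z) (b'_adj W) \<in> S" by (intro closed adjoint_on_in[OF endo_b'])
    fix X assume X: "X \<in> S"
    have "inner (br (b'_adj Z) (b'_adj W)) X *\<^sub>R a V = inner (br Z W) (b' X) *\<^sub>R a V"
      using formula_eq[of "[sharp Z, sharp W]" 1 V "[X]"] Z W X b'_in[OF X] sharp_in_dual[of _ S]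
      by (simp add: codifferential_formula_def wedge_tensor_def twisted_action_def flat_b' flat_sharp
          ad nths_Cons det_single sharp_apply linear_add[OF linear_a] linear_diff[OF linear_a]
          linear_neg[OF linear_a] linear_scale[OF linear_a])
    with aV have "inner (br (b'_adj Z) (b'_adj W)) X = inner (br Z W) (b' X)" by simp
    then show "inner X (b'_adj (br Z W)) = inner X (br (b'_adj Z) (b'_adj W))"
      using inner_adjoint_on[OF endo_b' X, of "br Z W"] by (simp add: inner_commute)
  qed
next
  fix k \<phi> assume *: "(\<forall>Z\<in>S. \<forall>V. a (adjoint (br Z) V) = adjoint (br (b'_adj Z)) (a V)) \<and>
    (\<forall>Z\<in>S. \<forall>W\<in>S. b'_adj (br Z W) = br (b'_adj Z) (b'_adj W))"
    and \<phi>: "\<phi> \<in> cochains S (Suc k)"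
  from \<phi> show "codifferential br S k (act (Suc k) \<phi>) = act k (codifferential br S k \<phi>)"
  proof (induction rule: cochain_induct)
    case (wedge \<alpha>s V)
    then have "set (map (\<lambda>\<alpha>. \<alpha> \<circ> b') \<alpha>s) \<subseteq> dual S" "length (map (\<lambda>\<alpha>. \<alpha> \<circ> b') \<alpha>s) = Suc k"
      using comp_b'_in_dual by auto
    from codifferential_wedge[OF this] show ?case
      using wedge * by (simp add: act_wedge codifferential_wedge act_codifferential_formula)
  next
    case (lincomb \<phi> \<psi> x y)
    then show ?case by (simp add: act_lincomb codifferential_lincomb act_in_cochains)
  qed
qed

end

section \<open>Derivatives in charts and the adjoint action\<close>

context smooth_manifold
begin

lemma chart_subset: "c \<in> A \<Longrightarrow> fst c \<subseteq> topspace T"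
  using chart_dom openin_subset by blast

lemma chart_point: "c \<in> A \<Longrightarrow> p \<in> fst c \<Longrightarrow> p \<in> topspace T"
  using chart_subset by blast

lemma chart_inj: "c \<in> A \<Longrightarrow> inj_on (snd c) (fst c)"
  using homeomorphic_imp_injective_map[OF chart_homeo[of c]] chart_subset[of c]
  by (simp add: Int_absorb1)

lemma chart_inv_chart: "c \<in> A \<Longrightarrow> p \<in> fst c \<Longrightarrow> chart_inv c (snd c p) = p"
  by (simp add: chart_inv_def chart_inj)

lemma open_chart_image:
  assumes c: "c \<in> A" and U: "openin T U"
  shows "open (snd c ` (fst c \<inter> U))"
proof -
  have "openin (subtopology T (fst c)) (fst c \<inter> U)" using U by (rule openin_subtopology_Int2)
  then have "openin (top_of_set (snd c ` fst c)) (snd c ` (fst c \<inter> U))"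
    using homeomorphic_imp_open_map[OF chart_homeo[OF c]] by (simp add: open_map_def)
  then show ?thesis using chart_range[OF c] by (simp add: openin_open_eq)
qed

lemma chart_around: "p \<in> topspace T \<Longrightarrow> \<exists>c\<in>A. p \<in> fst c"
  using cover by blast

text \<open>All differentials below are computed by exhibiting a function \<open>F\<close> that agrees with the coordinate
  expression of \<open>f\<close> on the image of a neighbourhood of \<open>p\<close>; outside the image of the chart the values of \<open>local_rep\<close> are arbitrary.\<close>

lemma has_derivative_local_rep_cong:
  assumes c: "c \<in> A" and p: "p \<in> fst c" and F: "(F has_derivative F') (at (snd c p))"
    and U: "openin T U" "p \<in> U" and eq: "\<And>q. q \<in> fst c \<Longrightarrow> q \<in> U \<Longrightarrow> snd d (f q) = F (snd c q)"
  shows "(local_rep c d f has_derivative F') (at (snd c p))"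
proof (rule has_derivative_transform_within_open[OF F open_chart_image[OF c U(1)]])
  show "snd c p \<in> snd c ` (fst c \<inter> U)" using p U by blast
  fix x assume "x \<in> snd c ` (fst c \<inter> U)"
  then show "F x = local_rep c d f x"
    using eq by (auto simp: local_rep_def chart_inv_chart[OF c])
qed

lemma chart_deriv_ident:
  assumes "c \<in> A" "p \<in> fst c"
  shows "chart_deriv c c (\<lambda>x. x) p = (\<lambda>v. v)"
proof -
  have "(local_rep c c (\<lambda>x. x) has_derivative (\<lambda>v. v)) (at (snd c p))"
    by (rule has_derivative_local_rep_cong[OF assms has_derivative_ident, of "topspace T"])
      (use assms chart_point in auto)
  then show ?thesis by (simp add: chart_deriv_def frechet_derivative_at[symmetric])
qed

lemma chart_deriv_cong:
  assumes "c \<in> A" "p \<in> fst c" and diff: "local_rep c d f differentiable (at (snd c p))"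
    and eq: "\<And>q. q \<in> topspace T \<Longrightarrow> f q = g q"
  shows "chart_deriv c d g p = chart_deriv c d f p"
proof -
  have "(local_rep c d g has_derivative chart_deriv c d f p) (at (snd c p))"
  proof (rule has_derivative_local_rep_cong[OF assms(1,2), of _ _ "topspace T"])
    show "(local_rep c d f has_derivative chart_deriv c d f p) (at (snd c p))"
      using diff by (simp add: chart_deriv_def frechet_derivative_works)
    fix q assume "q \<in> fst c" "q \<in> topspace T"
    with eq assms(1) show "snd d (g q) = local_rep c d f (snd c q)"
      by (simp add: local_rep_def chart_inv_chart)
  qed (use assms chart_point in auto)
  then show ?thesis by (simp add: chart_deriv_def frechet_derivative_at[symmetric])
qed

end

text \<open>Continuity of \<open>f\<close> makes the set where \<open>f\<close> takes values in the intermediate chart domain a neighbourhood of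
  \<open>p\<close>; on its image \<open>local_rep c e (g \<circ> f)\<close> is the composition of the two coordinate expressions.\<close>

lemma chart_chain_rule:
  assumes T: "smooth_manifold T A" and T': "smooth_manifold T' A'"
    and c: "c \<in> A" "p \<in> fst c" and d: "d \<in> A'" "f p \<in> fst d"
    and cont: "continuous_map T T' f"
    and f: "local_rep c d f differentiable (at (snd c p))"
    and g: "local_rep d e g differentiable (at (snd d (f p)))"
  shows local_rep_comp_differentiable: "local_rep c e (\<lambda>x. g (f x)) differentiable (at (snd c p))"
    and chart_deriv_comp:
      "chart_deriv c e (\<lambda>x. g (f x)) p = chart_deriv d e g (f p) \<circ> chart_deriv c d f p"
proof -
  interpret T: smooth_manifold T A by fact
  interpret T': smooth_manifold T' A' by fact
  let ?U = "{x \<in> topspace T. f x \<in> fst d}"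
  have rep: "local_rep c d f (snd c q) = snd d (f q)" if "q \<in> fst c" for q
    using that by (simp add: local_rep_def T.chart_inv_chart[OF c(1)])
  have "(local_rep d e g has_derivative chart_deriv d e g (f p)) (at (local_rep c d f (snd c p)))"
    using g by (simp add: rep[OF c(2)] chart_deriv_def frechet_derivative_works)
  moreover have "(local_rep c d f has_derivative chart_deriv c d f p) (at (snd c p))"
    using f by (simp add: chart_deriv_def frechet_derivative_works)
  ultimately have chain: "(local_rep d e g \<circ> local_rep c d f has_derivative
      chart_deriv d e g (f p) \<circ> chart_deriv c d f p) (at (snd c p))"
    by (rule diff_chain_at[rotated])
  have "(local_rep c e (\<lambda>x. g (f x)) has_derivative chart_deriv d e g (f p) \<circ> chart_deriv c d f p)
      (at (snd c p))"
  proof (rule T.has_derivative_local_rep_cong[OF c chain])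
    show "openin T ?U" using cont T'.chart_dom[OF d(1)] by (simp add: continuous_map_def)
    show "p \<in> ?U" using c d T.chart_point by auto
    fix q assume "q \<in> fst c" "q \<in> ?U"
    then show "snd e (g (f q)) = (local_rep d e g \<circ> local_rep c d f) (snd c q)"
      by (simp add: rep) (simp add: local_rep_def T'.chart_inv_chart[OF d(1)])
  qed
  then show "local_rep c e (\<lambda>x. g (f x)) differentiable (at (snd c p))"
    and "chart_deriv c e (\<lambda>x. g (f x)) p = chart_deriv d e g (f p) \<circ> chart_deriv c d f p"
    by (auto simp: differentiable_def chart_deriv_def frechet_derivative_at[symmetric])
qed

lemma smooth_map_differentiable:
  assumes "smooth_map T A T' A' f" "c \<in> A" "d \<in> A'" "p \<in> fst c" "f p \<in> fst d"
  shows "local_rep c d f differentiable (at (snd c p))"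
proof -
  have "Ck_on (Suc 0) (snd c ` {p \<in> fst c. f p \<in> fst d}) (local_rep c d f)"
    using assms unfolding smooth_map_def smooth_on_def by blast
  with assms(4,5) show ?thesis by auto
qed

lemma chart_inv_prod:
  assumes "inj_on (snd b) (fst b)" "inj_on (snd c) (fst c)" "p \<in> fst b" "q \<in> fst c"
  shows "chart_inv (fst b \<times> fst c, map_prod (snd b) (snd c)) (snd b p, snd c q) = (p, q)"
  using assms inv_into_f_f[OF map_prod_inj_on[OF assms(1,2)], of "(p, q)"]
  by (simp add: chart_inv_def)

context lie_group
begin

text \<open>Left and right translations at once: \<open>f\<close> and \<open>g\<close> will be the identity and a constant map, in either order, and
  \<open>\<sigma>\<close> is the coordinate expression of the slice \<open>x \<mapsto> (f x, g x)\<close> of the product.\<close>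

lemma mult_slice_differentiable:
  assumes c: "c \<in> A" "p \<in> fst c" and d: "d \<in> A" "f p \<otimes> g p \<in> fst d"
    and bs: "b1 \<in> A" "b2 \<in> A" "\<And>q. q \<in> fst c \<Longrightarrow> f q \<in> fst b1 \<and> g q \<in> fst b2"
    and \<sigma>: "\<sigma> differentiable (at (snd c p))"
      "\<And>q. q \<in> fst c \<Longrightarrow> \<sigma> (snd c q) = (snd b1 (f q), snd b2 (g q))"
  shows "local_rep c d (\<lambda>x. f x \<otimes> g x) differentiable (at (snd c p))"
proof -
  let ?b = "(fst b1 \<times> fst b2, map_prod (snd b1) (snd b2))"
  let ?m = "local_rep ?b d (\<lambda>(x, y). x \<otimes> y)"
  have "?b \<in> prod_atlas A A" using bs(1,2) unfolding prod_atlas_def by blast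
  then have "?m differentiable (at (snd ?b (f p, g p)))"
    using c d bs by (intro smooth_map_differentiable[OF smooth_mult]) auto
  then have "?m differentiable (at (\<sigma> (snd c p)))" using c \<sigma>(2) by simp
  then have "(?m \<circ> \<sigma>) differentiable (at (snd c p))"
    using \<sigma>(1) by (rule differentiable_chain_at[rotated])
  then obtain F' where F': "(?m \<circ> \<sigma> has_derivative F') (at (snd c p))"
    by (auto simp: differentiable_def)
  have "(local_rep c d (\<lambda>x. f x \<otimes> g x) has_derivative F') (at (snd c p))"
  proof (rule has_derivative_local_rep_cong[OF c F' openin_topspace])
    show "p \<in> topspace T" using c chart_point by blast
    fix q assume "q \<in> fst c"
    then show "snd d (f q \<otimes> g q) = (?m \<circ> \<sigma>) (snd c q)"
      using bs by (simp add: \<sigma>(2) local_rep_def chart_inv_prod chart_inj)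
  qed
  then show ?thesis by (auto simp: differentiable_def)
qed

lemma left_mult_differentiable:
  assumes "g \<in> carrier G" "c \<in> A" "p \<in> fst c" "d \<in> A" "g \<otimes> p \<in> fst d"
  shows "local_rep c d (\<lambda>x. g \<otimes> x) differentiable (at (snd c p))"
proof -
  obtain b where b: "b \<in> A" "g \<in> fst b" using chart_around assms(1) carrier_eq by blast
  show ?thesis
    by (rule mult_slice_differentiable[where f = "\<lambda>_. g" and g = "\<lambda>x. x" and ?b1.0 = b
          and ?b2.0 = c and \<sigma> = "\<lambda>y. (snd b g, y)"])
      (use assms b in \<open>auto simp: differentiable_def intro!: exI derivative_eq_intros\<close>)
qed

lemma right_mult_differentiable:
  assumes "g \<in> carrier G" "c \<in> A" "p \<in> fst c" "d \<in> A" "p \<otimes> g \<in> fst d"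
  shows "local_rep c d (\<lambda>x. x \<otimes> g) differentiable (at (snd c p))"
proof -
  obtain b where b: "b \<in> A" "g \<in> fst b" using chart_around assms(1) carrier_eq by blast
  show ?thesis
    by (rule mult_slice_differentiable[where f = "\<lambda>x. x" and g = "\<lambda>_. g" and ?b1.0 = c
          and ?b2.0 = b and \<sigma> = "\<lambda>y. (y, snd b g)"])
      (use assms b in \<open>auto simp: differentiable_def intro!: exI derivative_eq_intros\<close>)
qed

lemma continuous_mult:
  "continuous_map T T f \<Longrightarrow> continuous_map T T g \<Longrightarrow> continuous_map T T (\<lambda>x. f x \<otimes> g x)"
proof -
  assume "continuous_map T T f" "continuous_map T T g"
  then have "continuous_map T (prod_topology T T) (\<lambda>x. (f x, g x))"
    by (simp add: continuous_map_pairedI)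
  moreover have "continuous_map (prod_topology T T) T (\<lambda>(x, y). x \<otimes> y)"
    using smooth_mult by (simp add: smooth_map_def)
  ultimately show ?thesis using continuous_map_compose by (fastforce simp: comp_def)
qed

lemma continuous_conjugation:
  "g \<in> carrier G \<Longrightarrow> continuous_map T T (\<lambda>x. g \<otimes> x \<otimes> inv g)"
  by (intro continuous_mult continuous_map_id[unfolded id_def])
    (use carrier_eq inv_closed[of g] in \<open>auto simp: continuous_map_const\<close>)

text \<open>Conjugation by \<open>g\<close> is a left translation from \<open>\<one>\<close> to \<open>g\<close>, where another chart is needed, followed by a
  right translation back to \<open>\<one>\<close>.\<close>

lemma conjugation_differentiable:
  assumes g: "g \<in> carrier G" and c: "c \<in> A" "\<one> \<in> fst c"
  shows "local_rep c c (\<lambda>x. g \<otimes> x \<otimes> inv g) differentiable (at (snd c \<one>))"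
proof -
  obtain d where d: "d \<in> A" "g \<in> fst d" using chart_around g carrier_eq by blast
  show ?thesis
  proof (rule local_rep_comp_differentiable[OF _ _ c, where f = "\<lambda>x. g \<otimes> x" and d = d])
    show "continuous_map T T (\<lambda>x. g \<otimes> x)"
      using g carrier_eq
      by (intro continuous_mult continuous_map_id[unfolded id_def]) (auto simp: continuous_map_const)
  qed (use g c d in \<open>auto intro!: left_mult_differentiable right_mult_differentiable smooth_manifold_axioms\<close>)
qed

lemma linear_Ad:
  assumes "g \<in> carrier G" "c \<in> A" "\<one> \<in> fst c"
  shows "linear (Ad G c g)"
  unfolding Ad_def chart_deriv_def
  by (rule linear_frechet_derivative[OF conjugation_differentiable[OF assms]])

lemma Ad_Ad_inv:
  assumes g: "g \<in> carrier G" and c: "c \<in> A" "\<one> \<in> fst c"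
  shows "Ad G c g (Ad G c (inv g) X) = X"
proof -
  let ?K = "\<lambda>x. inv g \<otimes> x \<otimes> inv (inv g)" and ?L = "\<lambda>x. g \<otimes> x \<otimes> inv g"
  have g': "inv g \<in> carrier G" using g by simp
  have K1: "?K \<one> = \<one>" using g by simp
  have diff_K: "local_rep c c ?K differentiable (at (snd c \<one>))"
    using conjugation_differentiable[OF g' c] .
  have diff_L: "local_rep c c ?L differentiable (at (snd c (?K \<one>)))"
    using conjugation_differentiable[OF g c] unfolding K1 .
  have K1_in: "?K \<one> \<in> fst c" unfolding K1 by (rule c(2))
  note chain = chart_chain_rule[OF smooth_manifold_axioms smooth_manifold_axioms c c(1) K1_in
      continuous_conjugation[OF g'] diff_K diff_L]
  have "?L (?K q) = q" if "q \<in> topspace T" for q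
  proof -
    have q: "q \<in> carrier G" using that carrier_eq by simp
    have "?L (?K q) = g \<otimes> (inv g \<otimes> (q \<otimes> (g \<otimes> inv g)))"
      using g q by (simp add: m_assoc)
    also have "\<dots> = q" using g q by (simp add: m_assoc[symmetric])
    finally show ?thesis .
  qed
  then have "chart_deriv c c (\<lambda>x. x) \<one> = chart_deriv c c (\<lambda>x. ?L (?K x)) \<one>"
    by (rule chart_deriv_cong[OF c chain(1)])
  also have "\<dots> = Ad G c g \<circ> Ad G c (inv g)"
    using chain(2) unfolding K1 Ad_def .
  finally show ?thesis
    by (simp add: chart_deriv_ident[OF c] fun_eq_iff)
qed

end

text \<open>The inclusion of \<open>Q\<close> intertwines conjugation by \<open>g\<close> in \<open>Q\<close> and in the ambient group, so \<open>Ad\<^sub>g \<circ> J = J \<circ> Ad\<^sup>Q\<^sub>g\<close> for the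
  differential \<open>J\<close> of the inclusion at \<open>\<one>\<close>, whose range is \<open>\<qq>\<close>.\<close>

lemma Ad_preserves_subgroup_algebra:
  assumes H: "lie_group H T A" and c: "c \<in> A" "\<one>\<^bsub>H\<^esub> \<in> fst c"
    and Q: "connected_lie_subgroup_with_algebra Q TQ AQ H T A c \<qq>"
    and g: "g \<in> Q" and X: "X \<in> \<qq>"
  shows "Ad H c g X \<in> \<qq>"
proof -
  let ?K = "H\<lparr>carrier := Q\<rparr>"
  let ?conj = "\<lambda>x. g \<otimes>\<^bsub>H\<^esub> x \<otimes>\<^bsub>H\<^esub> inv\<^bsub>H\<^esub> g"
  interpret H: lie_group H T A by fact
  interpret K: lie_group ?K TQ AQ using Q by (simp add: connected_lie_subgroup_with_algebra_def)
  have sub: "subgroup Q H" and imm: "immersion TQ AQ T A id"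
    using Q by (auto simp: connected_lie_subgroup_with_algebra_def)
  have smooth_id: "smooth_map TQ AQ T A id" using imm by (simp add: immersion_def)
  have gH: "g \<in> carrier H" using sub g subgroup.subset by blast
  have "\<one>\<^bsub>H\<^esub> \<in> topspace TQ" using K.carrier_eq K.one_closed by simp
  then obtain d where d: "d \<in> AQ" "\<one>\<^bsub>H\<^esub> \<in> fst d" using K.chart_around by blast
  define J where "J = chart_deriv d c id \<one>\<^bsub>H\<^esub>"
  have range_J: "range J = \<qq>"
    using Q d by (auto simp: connected_lie_subgroup_with_algebra_def J_def)
  have inv_eq: "inv\<^bsub>?K\<^esub> g = inv\<^bsub>H\<^esub> g"
    using H.m_inv_consistent[OF sub g] .
  have conj_one: "?conj \<one>\<^bsub>H\<^esub> = \<one>\<^bsub>H\<^esub>" using gH by simp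
  have cont_id: "continuous_map TQ T id" using smooth_id by (simp only: smooth_map_def)
  have diff_id: "local_rep d c id differentiable (at (snd d \<one>\<^bsub>H\<^esub>))"
    using smooth_map_differentiable[OF smooth_id d(1) c(1) d(2)] c by simp
  have diff_H: "local_rep c c ?conj differentiable (at (snd c \<one>\<^bsub>H\<^esub>))"
    using H.conjugation_differentiable[OF gH c] .
  have diff_K: "local_rep d d ?conj differentiable (at (snd d \<one>\<^bsub>H\<^esub>))"
    using K.conjugation_differentiable[of g d] g d inv_eq by simp
  have cont_K: "continuous_map TQ TQ ?conj"
    using K.continuous_conjugation[of g] g inv_eq by simp
  have "chart_deriv d c (\<lambda>x. ?conj (id x)) \<one>\<^bsub>H\<^esub> = chart_deriv c c ?conj (id \<one>\<^bsub>H\<^esub>) \<circ> J"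
    unfolding J_def
    by (rule chart_deriv_comp[where f = id and g = ?conj,
          OF K.smooth_manifold_axioms H.smooth_manifold_axioms d c(1)])
      (simp_all only: id_apply c diff_id diff_H cont_id)
  moreover have "chart_deriv d c (\<lambda>x. id (?conj x)) \<one>\<^bsub>H\<^esub> =
      chart_deriv d c id (?conj \<one>\<^bsub>H\<^esub>) \<circ> chart_deriv d d ?conj \<one>\<^bsub>H\<^esub>"
    by (rule chart_deriv_comp[where f = ?conj and g = id, OF K.smooth_manifold_axioms K.smooth_manifold_axioms d d(1)])
      (use d diff_id diff_K cont_K in \<open>simp_all add: conj_one del: H.r_one\<close>)
  ultimately have "Ad H c g \<circ> J = J \<circ> chart_deriv d d ?conj \<one>\<^bsub>H\<^esub>"
    by (simp add: Ad_def J_def conj_one del: H.r_one)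
  then have "Ad H c g (J v) \<in> range J" for v
    by (metis comp_apply rangeI)
  with range_J X show ?thesis by blast
qed

section \<open>The negative part and the quotient action\<close>

context fundamental_graded_lie_algebra
begin

lemma subspace_neg_part: "subspace (neg_part h)" and subspace_nonneg_part: "subspace (nonneg_part h)"
  by (simp_all add: neg_part_def nonneg_part_def)

lemma neg_part_closed:
  assumes "X \<in> neg_part h" "Y \<in> neg_part h"
  shows "br X Y \<in> neg_part h"
proof -
  have "lie_subalgebra br (lie_subalgebra br hull h (- 1))"
    by (rule hull_in) (auto simp: lie_subalgebra_def intro!: subspace_Inter)
  then have "lie_subalgebra br (neg_part h)" by (simp add: generated)
  with assms show ?thesis by (simp add: lie_subalgebra_def)
qed

lemma neg_nonneg_decomposition: "\<exists>Y\<in>neg_part h. X - Y \<in> nonneg_part h"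
proof -
  obtain x where x: "\<And>i. x i \<in> h i" "X = (\<Sum>i = - k0..l. x i)" using direct_sum by blast
  let ?Y = "\<Sum>i\<in>{- k0..l} \<inter> {..<0}. x i"
  have "?Y \<in> neg_part h"
    unfolding neg_part_def by (rule span_sum) (use x in \<open>auto intro!: span_base\<close>)
  moreover have "X - ?Y = (\<Sum>i\<in>{- k0..l} - {..<0}. x i)"
    unfolding x(2) using sum.Int_Diff[of "{- k0..l}" x "{..<0}"] by simp
  moreover have "\<dots> \<in> nonneg_part h"
    unfolding nonneg_part_def
  proof (rule span_sum)
    fix i assume "i \<in> {- k0..l} - {..<0}"
    then have "i \<in> {0..}" by auto
    with x(1)[of i] show "x i \<in> span (\<Union>i\<in>{0..}. h i)" by (intro span_base) blast
  qed
  ultimately show ?thesis by metis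
qed

lemma neg_orthogonal_nonneg:
  assumes "adapted_metric h" "X \<in> neg_part h" "Y \<in> nonneg_part h"
  shows "inner X Y = 0"
proof -
  have base: "inner x y = 0" if "x \<in> h i" "i < 0" "y \<in> h j" "j \<ge> 0" for x y i j
  proof -
    have "i \<noteq> j" using that by simp
    with assms(1) that show ?thesis unfolding adapted_metric_def by blast
  qed
  have "Linear_Algebra.orthogonal x Y" if "x \<in> h i" "i < 0" for x i
    using assms(3)[unfolded nonneg_part_def]
    by (rule orthogonal_to_span) (use base that in \<open>auto simp: Linear_Algebra.orthogonal_def\<close>)
  then have "Linear_Algebra.orthogonal Y x" if "x \<in> h i" "i < 0" for x i
    using that by (metis orthogonal_commute)
  then have "Linear_Algebra.orthogonal Y x" if "x \<in> (\<Union>i\<in>{..<0}. h i)" for x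
    using that by blast
  with assms(2)[unfolded neg_part_def] have "Linear_Algebra.orthogonal Y X"
    by (rule orthogonal_to_span)
  then show ?thesis by (simp add: Linear_Algebra.orthogonal_def inner_commute)
qed

lemma neg_nonneg_decomposition_unique:
  assumes "adapted_metric h" "Y \<in> neg_part h" "X - Y \<in> nonneg_part h"
    "Y' \<in> neg_part h" "X - Y' \<in> nonneg_part h"
  shows "Y = Y'"
proof -
  have "Y - Y' \<in> neg_part h" using assms subspace_neg_part by (simp add: subspace_diff)
  moreover have "Y - Y' \<in> nonneg_part h"
    using subspace_diff[OF subspace_nonneg_part assms(5,3)] by simp
  ultimately have "inner (Y - Y') (Y - Y') = 0" by (rule neg_orthogonal_nonneg[OF assms(1)])
  then show ?thesis by simp
qed

lemma Ad_neg_eqI: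
  assumes "adapted_metric h" "Y \<in> neg_part h" "Ad H c g X - Y \<in> nonneg_part h"
  shows "Ad_neg H c h g X = Y"
  unfolding Ad_neg_def
  by (rule the_equality) (use assms in \<open>auto intro: neg_nonneg_decomposition_unique\<close>)

lemma Ad_neg_works:
  assumes "adapted_metric h"
  shows "Ad_neg H c h g X \<in> neg_part h \<and> Ad H c g X - Ad_neg H c h g X \<in> nonneg_part h"
  using neg_nonneg_decomposition[of "Ad H c g X"] Ad_neg_eqI[OF assms] by metis

lemma endomorphism_on_Ad_neg:
  assumes m: "adapted_metric h" and lin: "linear (Ad H c g)"
  shows "endomorphism_on (neg_part h) (Ad_neg H c h g)"
  unfolding endomorphism_on_def
proof (intro conjI ballI allI)
  note * = Ad_neg_works[OF m, of H c g]
  show "Ad_neg H c h g X \<in> neg_part h" for X using * by simp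
  show "Ad_neg H c h g (X + Y) = Ad_neg H c h g X + Ad_neg H c h g Y" for X Y
    using *[of X] *[of Y] subspace_add[OF subspace_neg_part]
      subspace_add[OF subspace_nonneg_part, of "Ad H c g X - Ad_neg H c h g X" "Ad H c g Y - Ad_neg H c h g Y"]
    by (intro Ad_neg_eqI[OF m]) (simp_all add: linear_add[OF lin] algebra_simps)
  show "Ad_neg H c h g (r *\<^sub>R X) = r *\<^sub>R Ad_neg H c h g X" for r X
    using *[of X] subspace_scale[OF subspace_neg_part]
      subspace_scale[OF subspace_nonneg_part, of "Ad H c g X - Ad_neg H c h g X" r]
    by (intro Ad_neg_eqI[OF m]) (simp_all add: linear_scale[OF lin] algebra_simps)
qed

text \<open>On the quotient by the nonnegative part, \<open>Ad\<^sub>g\<close> is well defined because it preserves that part, and it inherits the inverse.\<close>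

lemma Ad_neg_inverse:
  assumes m: "adapted_metric h" and lin: "linear (Ad H c g)"
    and inv: "\<And>X. Ad H c g (Ad H c g' X) = X"
    and pres: "\<And>X. X \<in> nonneg_part h \<Longrightarrow> Ad H c g X \<in> nonneg_part h"
    and X: "X \<in> neg_part h"
  shows "Ad_neg H c h g (Ad_neg H c h g' X) = X"
proof (rule Ad_neg_eqI[OF m X])
  let ?Y = "Ad_neg H c h g' X"
  have "Ad H c g (Ad H c g' X - ?Y) \<in> nonneg_part h"
    by (rule pres[OF conjunct2[OF Ad_neg_works[OF m]]])
  then have "X - Ad H c g ?Y \<in> nonneg_part h" by (simp add: linear_diff[OF lin] inv)
  then show "Ad H c g ?Y - X \<in> nonneg_part h"
    using subspace_neg[OF subspace_nonneg_part, of "X - Ad H c g ?Y"] by simp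
qed

end

lemma parseval_frame_exists:
  fixes S :: "'h::euclidean_space set"
  assumes "subspace S"
  shows "\<exists>E. parseval_frame S E"
proof -
  obtain E where E: "E \<subseteq> S" "pairwise Linear_Algebra.orthogonal E" "\<And>x. x \<in> E \<Longrightarrow> norm x = 1"
    "independent E" "span E = S"
    using orthonormal_basis_subspace[OF assms] by metis
  have fin: "finite E" using E(4) by (rule independent_imp_finite)
  have orth: "inner e f = (if e = f then 1 else 0)" if "e \<in> E" "f \<in> E" for e f
    using that E(2) E(3)[of e] by (auto simp: pairwise_def Linear_Algebra.orthogonal_def norm_eq_1)
  have "(\<Sum>e\<in>E. inner e X *\<^sub>R e) = X" if "X \<in> S" for X
  proof -
    have "X \<in> span E" using that E(5) by simp
    then obtain u where X: "X = (\<Sum>e\<in>E. u e *\<^sub>R e)" using span_finite[OF fin] by auto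
    have "inner e X = u e" if "e \<in> E" for e
      using that fin by (simp add: X inner_sum_right orth if_distrib cong: if_cong)
    then show ?thesis by (simp add: X)
  qed
  with assms fin E(1) show ?thesis by (auto simp: parseval_frame_def)
qed

section \<open>Codifferential and admissible metrics\<close>

theorem proposition6:
  fixes br :: "'h::euclidean_space \<Rightarrow> 'h \<Rightarrow> 'h" and h :: "int \<Rightarrow> 'h set" and k0 l :: int
    and H :: "'g monoid" and T :: "'g topology" and A :: "('g, 'h) chart set" and c :: "('g, 'h) chart"
    and Q :: "'g set" and TQ :: "'g topology" and AQ :: "('g, 'q::euclidean_space) chart set"
  assumes "fundamental_graded_lie_algebra br h k0 l"
    and "adapted_metric h"
  shows
    "(\<forall>k \<alpha>s V. length \<alpha>s = Suc k \<and> set \<alpha>s \<subseteq> dual (neg_part h) \<longrightarrow>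
        codifferential br (neg_part h) k (wedge_tensor (neg_part h) \<alpha>s V) =
        (\<lambda>Xs.
          (\<Sum>i\<le>k. (- 1) ^ i *\<^sub>R
             wedge_tensor (neg_part h) (nths \<alpha>s (- {i}))
               (adjoint (br (flat (neg_part h) (\<alpha>s ! i))) V) Xs) +
          (\<Sum>j\<le>k. \<Sum>i<j. (- 1) ^ (i + j) *\<^sub>R
             wedge_tensor (neg_part h)
               (sharp (br (flat (neg_part h) (\<alpha>s ! i)) (flat (neg_part h) (\<alpha>s ! j))) # nths \<alpha>s (- {i, j}))
               V Xs)))
     \<and>
     (connected_lie_group_with_algebra H T A c br \<and>
      connected_lie_subgroup_with_algebra Q TQ AQ H T A c (nonneg_part h) \<longrightarrow>
        (admissible_metric br h H c Q \<longleftrightarrow>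
          (\<forall>g\<in>Q. \<forall>Z\<in>neg_part h. \<forall>W.
             adjoint (Ad H c g) (br Z W) =
             br (adjoint_on (neg_part h) (Ad_neg H c h g) Z) (adjoint (Ad H c g) W)) \<and>
          (\<forall>g\<in>Q. \<forall>Z\<in>neg_part h. \<forall>W\<in>neg_part h.
             adjoint_on (neg_part h) (Ad_neg H c h g) (br Z W) =
             br (adjoint_on (neg_part h) (Ad_neg H c h g) Z) (adjoint_on (neg_part h) (Ad_neg H c h g) W))))"
proof -
  interpret fundamental_graded_lie_algebra br h k0 l by fact
  let ?S = "neg_part h"
  obtain E where E: "parseval_frame ?S E" using parseval_frame_exists[OF subspace_neg_part] by blast
  have lie: "lie_algebra_with_subalgebra br ?S"
    by (simp add: lie_algebra_with_subalgebra_def lie_algebra_with_subalgebra_axioms_def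
        lie_algebra_axioms subspace_neg_part neg_part_closed)
  interpret S: metric_lie_subalgebra ?S E br
    using E lie by (simp add: metric_lie_subalgebra_def)
  have equivariant: "(\<forall>k. \<forall>\<phi>\<in>cochains ?S (Suc k).
      codifferential br ?S k (cochain_action H c h (Suc k) g \<phi>) =
      cochain_action H c h k g (codifferential br ?S k \<phi>)) \<longleftrightarrow>
      (\<forall>Z\<in>?S. \<forall>W. adjoint (Ad H c g) (br Z W) =
        br (adjoint_on ?S (Ad_neg H c h g) Z) (adjoint (Ad H c g) W)) \<and>
      (\<forall>Z\<in>?S. \<forall>W\<in>?S. adjoint_on ?S (Ad_neg H c h g) (br Z W) =
        br (adjoint_on ?S (Ad_neg H c h g) Z) (adjoint_on ?S (Ad_neg H c h g) W))"
    if H: "connected_lie_group_with_algebra H T A c br"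
      and Q: "connected_lie_subgroup_with_algebra Q TQ AQ H T A c (nonneg_part h)" and g: "g \<in> Q" for g
  proof -
    interpret H: connected_lie_group_with_algebra H T A c br by fact
    let ?g' = "inv\<^bsub>H\<^esub> g"
    have sub: "subgroup Q H" using Q by (simp add: connected_lie_subgroup_with_algebra_def)
    have g': "?g' \<in> Q" using sub g by (rule subgroup.m_inv_closed)
    have gH: "g \<in> carrier H" using sub g subgroup.subset by blast
    note c = H.chart_at_one
    have g'H: "?g' \<in> carrier H" using gH by simp
    have lin: "linear (Ad H c g)" "linear (Ad H c ?g')"
      by (rule H.linear_Ad[OF gH c], rule H.linear_Ad[OF g'H c])
    have inv: "Ad H c g (Ad H c ?g' X) = X" "Ad H c ?g' (Ad H c g X) = X" for X
      using H.Ad_Ad_inv[OF gH c, of X] H.Ad_Ad_inv[OF g'H c, of X] H.inv_inv[OF gH] by simp_all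
    have pres: "Ad H c x X \<in> nonneg_part h" if "x \<in> Q" "X \<in> nonneg_part h" for x X
      using H.lie_group_axioms c Q that by (rule Ad_preserves_subgroup_algebra)
    interpret S: twisted_metric_lie_subalgebra ?S E br "Ad H c g" "Ad_neg H c h g" "Ad_neg H c h ?g'"
    proof
      show "inj (Ad H c g)" using inv(2) by (metis injI)
      show "endomorphism_on ?S (Ad_neg H c h g)" "endomorphism_on ?S (Ad_neg H c h ?g')"
        using endomorphism_on_Ad_neg[OF assms(2) lin(1)] endomorphism_on_Ad_neg[OF assms(2) lin(2)] by simp_all
      show "Ad_neg H c h g (Ad_neg H c h ?g' X) = X" "Ad_neg H c h ?g' (Ad_neg H c h g X) = X"
        if "X \<in> ?S" for X
        using Ad_neg_inverse[OF assms(2) lin(1) inv(1) pres[OF g] that]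
          Ad_neg_inverse[OF assms(2) lin(2) inv(2) pres[OF g'] that] by auto
    qed (simp_all add: linear_add[OF lin(1)] linear_scale[OF lin(1)])
    have "cochain_action H c h k g \<phi> = twisted_action ?S (Ad H c g) (Ad_neg H c h ?g') k \<phi>" for k \<phi>
      by (rule ext) (simp add: cochain_action_def twisted_action_def)
    then show ?thesis using S.codifferential_equivariant_iff by simp
  qed
  show ?thesis
  proof (intro conjI impI allI, goal_cases)
    case (1 k \<alpha>s V)
    then show ?case using S.codifferential_wedge[of \<alpha>s k V] by (simp add: codifferential_formula_def)
  next
    case 2
    then have "\<forall>g\<in>Q. (\<forall>k. \<forall>\<phi>\<in>cochains ?S (Suc k).
      codifferential br ?S k (cochain_action H c h (Suc k) g \<phi>) =
      cochain_action H c h k g (codifferential br ?S k \<phi>)) \<longleftrightarrow>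
      (\<forall>Z\<in>?S. \<forall>W. adjoint (Ad H c g) (br Z W) =
        br (adjoint_on ?S (Ad_neg H c h g) Z) (adjoint (Ad H c g) W)) \<and>
      (\<forall>Z\<in>?S. \<forall>W\<in>?S. adjoint_on ?S (Ad_neg H c h g) (br Z W) =
        br (adjoint_on ?S (Ad_neg H c h g) Z) (adjoint_on ?S (Ad_neg H c h g) W))"
      using equivariant by simp
    then show ?case unfolding admissible_metric_def by blast
  qed
qed

end
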